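(* Let $n\ge 1$, let $A=(a_1,\ldots,a_k)$ be positive integers with $a_1+\cdots+a_k=n$, and let $S\subseteq\{1,\ldots,k\}$. Let $\Phi$ be the map sending a permutation $\pi$ of $\{1,\ldots,n\}$ to the ornament obtained by writing $\pi$ as a product of disjoint cycles (fixed points included as cycles of length $1$) and replacing each element $x$ of each cycle by the index $i$ of the block $A_i$ containing $x$. Then $\Phi$ restricted to the set of $(A,S)$-permutations is injective, it preserves cycle structure (the multiset of necklace lengths of $\Phi(\pi)$ equals the multiset of cycle lengths of $\pi$), and its image is exactly the set of $A$-compatible ornaments satisfying all three of the following conditions: (1) if the fundamental period of a necklace contains an even number of entries whose color lies in $S$, then the necklace is $1$-repeating; (2) if the fundamental period of a necklace contains an odd number of entries whose color lies in $S$, then the necklace is $1$-repeating or $2$-repeating; (3) if a necklace contains an odd number of entries whose color lies in $S$, then no other necklace in the ornament is identical to it.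
   Context: Blocks: $A_i=\{a_1+\cdots+a_{i-1}+1,\ldots,a_1+\cdots+a_i\}$, consecutive intervals partitioning $\{1,\ldots,n\}$. An $(A,S)$-permutation is a permutation $\pi$ of $\{1,\ldots,n\}$ such that for every $i$ and all consecutive $j,j+1\in A_i$, $\pi(j)>\pi(j+1)$ if $i\in S$ and $\pi(j)<\pi(j+1)$ if $i\notin S$. A necklace of length $m$ colored by $\{1,\ldots,k\}$ is a sequence $(c_0,\ldots,c_{m-1})$ of colors taken up to cyclic rotation (a directed cycle with colored vertices); an ornament is a finite multiset of necklaces. The fundamental period of a necklace is the shortest contiguous block $P$ such that the necklace is the concatenation of $r$ copies of $P$ for some $r$; the necklace is then called $r$-repeating. An ornament is $A$-compatible if, for each $i$, exactly $a_i$ vertices (over all necklaces) have color $i$. *)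

theory Defs
  imports
    "HOL-Library.Multiset"
    "HOL-Combinatorics.Permutations"
    "HOL-Combinatorics.Cycles"
    "HOL-Combinatorics.Orbits"
begin

section \<open>Blocks and permutations with prescribed ascents and descents\<close>

definition block :: "(nat \<Rightarrow> nat) \<Rightarrow> nat \<Rightarrow> nat set" where
  "block a i = {(\<Sum>j\<in>{1..<i}. a j) + 1 .. (\<Sum>j\<in>{1..i}. a j)}"

text \<open>Meaningful only for points of the union of the blocks \<open>1, \<dots>, k\<close>.\<close>

definition block_index :: "(nat \<Rightarrow> nat) \<Rightarrow> nat \<Rightarrow> nat \<Rightarrow> nat" where
  "block_index a k x = (THE i. i \<in> {1..k} \<and> x \<in> block a i)"

definition AS_permutations ::
    "nat \<Rightarrow> nat \<Rightarrow> (nat \<Rightarrow> nat) \<Rightarrow> nat set \<Rightarrow> (nat \<Rightarrow> nat) set" where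
  "AS_permutations n k a S =
     {\<pi>. \<pi> permutes {1..n} \<and>
        (\<forall>i\<in>{1..k}. \<forall>j. j \<in> block a i \<and> j + 1 \<in> block a i \<longrightarrow>
           (if i \<in> S then \<pi> j > \<pi> (j + 1) else \<pi> j < \<pi> (j + 1)))}"


section \<open>Necklaces and ornaments\<close>

definition rotation_of :: "'c list \<Rightarrow> 'c list \<Rightarrow> bool" where
  "rotation_of xs ys \<longleftrightarrow> (\<exists>m. ys = rotate m xs)"

lemma equivp_rotation_of: "equivp (rotation_of :: 'c list \<Rightarrow> 'c list \<Rightarrow> bool)"
proof (rule equivpI)
  show "reflp (rotation_of :: 'c list \<Rightarrow> 'c list \<Rightarrow> bool)"
    unfolding reflp_def rotation_of_def by (metis rotate0 id_apply)
  show "symp (rotation_of :: 'c list \<Rightarrow> 'c list \<Rightarrow> bool)"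
  proof (rule sympI)
    fix xs ys :: "'c list"
    assume "rotation_of xs ys"
    then obtain m where ys: "ys = rotate m xs"
      by (auto simp: rotation_of_def)
    have "(length xs - m mod length xs + m) mod length xs = 0" if "xs \<noteq> []"
    proof -
      have "m mod length xs < length xs"
        using that by simp
      then have "(length xs - m mod length xs + m mod length xs) mod length xs = 0"
        by simp
      then show ?thesis
        by (metis mod_add_right_eq)
    qed
    then have "rotate (length xs - m mod length xs) ys = xs"
      unfolding ys rotate_rotate by (cases "xs = []") (auto intro: rotate_id)
    then show "rotation_of ys xs"
      unfolding rotation_of_def by metis
  qed
  show "transp (rotation_of :: 'c list \<Rightarrow> 'c list \<Rightarrow> bool)"
    unfolding rotation_of_def by (rule transpI) (auto simp: rotate_rotate)
qed

text \<open>
  The quotient is taken over all lists, so the type also contains the class of the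
  empty list; it is excluded in \<open>ornaments\<close> below.
\<close>

quotient_type 'c necklace = "'c list" / rotation_of
  by (rule equivp_rotation_of)

lift_definition necklace_of :: "'c list \<Rightarrow> 'c necklace" is "\<lambda>xs. xs" .

lift_definition necklace_entries :: "'c necklace \<Rightarrow> 'c multiset" is mset
  by (clarsimp simp: rotation_of_def rotate_drop_take)
    (metis append_take_drop_id mset_append union_commute)

lift_definition necklace_length :: "'c necklace \<Rightarrow> nat" is length
  by (auto simp: rotation_of_def)

lift_definition recolor :: "('b \<Rightarrow> 'c) \<Rightarrow> 'b necklace \<Rightarrow> 'c necklace" is map
  by (auto simp: rotation_of_def rotate_map)

definition fundamental_period :: "'c necklace \<Rightarrow> 'c list \<Rightarrow> bool" where
  "fundamental_period N P \<longleftrightarrow>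
     is_arg_min length (\<lambda>Q. \<exists>r. N = necklace_of (concat (replicate r Q))) P"

definition repeating :: "nat \<Rightarrow> 'c necklace \<Rightarrow> bool" where
  "repeating r N \<longleftrightarrow>
     (\<exists>P. fundamental_period N P \<and> N = necklace_of (concat (replicate r P)))"

definition ornaments :: "nat \<Rightarrow> nat necklace multiset set" where
  "ornaments k =
     {\<Omega>. \<forall>N\<in>#\<Omega>. necklace_length N > 0 \<and> set_mset (necklace_entries N) \<subseteq> {1..k}}"

definition compatible :: "nat \<Rightarrow> (nat \<Rightarrow> nat) \<Rightarrow> nat necklace multiset \<Rightarrow> bool" where
  "compatible k a \<Omega> \<longleftrightarrow>
     (\<forall>i\<in>{1..k}. (\<Sum>N\<in>#\<Omega>. count (necklace_entries N) i) = a i)"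


section \<open>From permutations to ornaments\<close>

text \<open>
  The disjoint cycles of \<open>\<pi>\<close> on \<open>{1..n}\<close>, each written as \<open>(x, \<pi> x, \<pi> (\<pi> x), \<dots>)\<close> up to
  rotation; since this is a set, the cycles reached from several \<open>x\<close> are not repeated.
\<close>

definition disjoint_cycles :: "nat \<Rightarrow> (nat \<Rightarrow> nat) \<Rightarrow> nat necklace set" where
  "disjoint_cycles n \<pi> = (\<lambda>x. necklace_of (support \<pi> x)) ` {1..n}"

definition ornament_of ::
    "nat \<Rightarrow> nat \<Rightarrow> (nat \<Rightarrow> nat) \<Rightarrow> (nat \<Rightarrow> nat) \<Rightarrow> nat necklace multiset" where
  "ornament_of n k a \<pi> =
     image_mset (recolor (block_index a k)) (mset_set (disjoint_cycles n \<pi>))"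

definition cycle_lengths :: "nat \<Rightarrow> (nat \<Rightarrow> nat) \<Rightarrow> nat multiset" where
  "cycle_lengths n \<pi> = image_mset card (mset_set (orbit \<pi> ` {1..n}))"

end

theory Submission
  imports Defs
begin

text \<open>
  Attach to a point \<open>x\<close> the infinite word of the colours of \<open>x, \<pi> x, \<pi> (\<pi> x), \<dots>\<close>. For an
  \<open>(A,S)\<close>-permutation the points are weakly sorted by their words with respect to the lexicographic
  order in which every letter of \<open>S\<close> reverses the subsequent comparison. The ornament determines the
  multiset of words, hence the word of each point, and then \<open>\<pi>\<close>, which maps the points with word
  \<open>w\<close> onto those with the shifted word, monotonically or antitonically. Conversely, sorting
  the words of any compatible ornament yields an \<open>(A,S)\<close>-permutation in this way.

  If \<open>w\<close> has period \<open>p\<close>, then \<open>\<pi>\<^sup>p\<close> acts on the points with word \<open>w\<close> either as an increasing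
  permutation, that is, the identity, or as the reversal, according to the parity of the number of
  letters of \<open>S\<close> in the period. This gives the three conditions, and under these an ornament is
  determined by its multiset of words.
\<close>

section \<open>Sorted listings\<close>

lemma card_Collect_eq_size_filter:
  assumes "finite V"
  shows "card {y\<in>V. P (f y)} = size (filter_mset P (image_mset f (mset_set V)))"
  using assms by (simp add: filter_mset_image_mset)

lemma count_image_mset_mset_set:
  assumes "finite V"
  shows "count (image_mset f (mset_set V)) y = card {x\<in>V. f x = y}"
proof -
  have "count (image_mset f (mset_set V)) y = (\<Sum>x\<in>{x\<in>V. f x = y}. count (mset_set V) x)"
    unfolding count_image_mset' using assms by (intro sum.cong) auto
  also have "\<dots> = card {x\<in>V. f x = y}"
    using assms by simp
  finally show ?thesis .
qed

text \<open>In a sorted listing, the number of entries below a value controls its position. If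
  \<open>f x\<close> were below \<open>g x\<close>, then at least \<open>x\<close> entries of
  \<open>f\<close> but at most \<open>x - 1\<close> entries of \<open>g\<close> would lie below
  \<open>g x\<close>, although both list the same multiset.\<close>

lemma sorted_listing_unique:
  fixes f g :: "nat \<Rightarrow> 'a"
  assumes order: "transp lt" "irreflp lt" "totalp lt"
    and f: "\<And>x y. x \<in> {1..n} \<Longrightarrow> y \<in> {1..n} \<Longrightarrow> x < y \<Longrightarrow> \<not> lt (f y) (f x)"
    and g: "\<And>x y. x \<in> {1..n} \<Longrightarrow> y \<in> {1..n} \<Longrightarrow> x < y \<Longrightarrow> \<not> lt (g y) (g x)"
    and eq: "image_mset f (mset_set {1..n}) = image_mset g (mset_set {1..n})"
    and x: "x \<in> {1..n}"
  shows "f x = g x"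
proof -
  \<comment> \<open>The hypotheses are repeated for arbitrary listings so that the claim can also be
    used with \<open>f\<close> and \<open>g\<close> exchanged.\<close>
  have no_less: "\<not> lt (f x) (g x)"
    if f: "\<And>x y. x \<in> {1..n} \<Longrightarrow> y \<in> {1..n} \<Longrightarrow> x < y \<Longrightarrow> \<not> lt (f y) (f x)"
      and g: "\<And>x y. x \<in> {1..n} \<Longrightarrow> y \<in> {1..n} \<Longrightarrow> x < y \<Longrightarrow> \<not> lt (g y) (g x)"
      and eq: "image_mset f (mset_set {1..n}) = image_mset g (mset_set {1..n})"
    for f g
  proof
    assume less: "lt (f x) (g x)"
    have "lt (f y) (g x)" if "y \<in> {1..x}" for y
    proof (cases "y = x")
      case False
      then have "\<not> lt (f x) (f y)"
        using f[of y x] x that by auto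
      then have "f y = f x \<or> lt (f y) (f x)"
        using order(3) unfolding totalp_on_def by blast
      then show ?thesis
        using less order(1) by (metis transpD)
    qed (use less in simp)
    then have "{1..x} \<subseteq> {y\<in>{1..n}. lt (f y) (g x)}"
      using x by auto
    from card_mono[OF _ this] have "x \<le> card {y\<in>{1..n}. lt (f y) (g x)}"
      by simp
    also have "\<dots> = card {y\<in>{1..n}. lt (g y) (g x)}"
      using eq card_Collect_eq_size_filter[of "{1..n}" "\<lambda>v. lt v (g x)"] by simp
    also have "{y\<in>{1..n}. lt (g y) (g x)} \<subseteq> {1..<x}"
      using g[of x] x order(2) by (auto simp: irreflp_def) (metis linorder_neqE_nat not_le)
    from card_mono[OF _ this] have "card {y\<in>{1..n}. lt (g y) (g x)} \<le> x - 1"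
      by simp
    finally show False
      using x by (cases x) auto
  qed
  have "\<not> lt (f x) (g x)" "\<not> lt (g x) (f x)"
    using no_less[of f g] no_less[of g f] f g eq by simp_all
  then show ?thesis
    using order(3) unfolding totalp_on_def by blast
qed

text \<open>The rank of an element is one more than the number of its predecessors, so that ranks
  start at \<open>1\<close> like the points permuted later.\<close>

lemma ranking_exists:
  assumes fin: "finite V"
    and trans: "\<And>u v w. u \<in> V \<Longrightarrow> v \<in> V \<Longrightarrow> w \<in> V \<Longrightarrow> R u v \<Longrightarrow> R v w \<Longrightarrow> R u w"
    and irrefl: "\<And>u. u \<in> V \<Longrightarrow> \<not> R u u"
    and total: "\<And>u v. u \<in> V \<Longrightarrow> v \<in> V \<Longrightarrow> u \<noteq> v \<Longrightarrow> R u v \<or> R v u"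
  obtains r where "bij_betw r V {1..card V}"
    and "\<And>u v. u \<in> V \<Longrightarrow> v \<in> V \<Longrightarrow> r u < (r v :: nat) \<longleftrightarrow> R u v"
proof
  define r where "r v = Suc (card {u\<in>V. R u v})" for v
  have mono: "r u < r v" if "u \<in> V" "v \<in> V" "R u v" for u v
  proof -
    have "{w\<in>V. R w u} \<subset> {w\<in>V. R w v}"
      using that trans irrefl by blast
    then show ?thesis
      unfolding r_def using fin by (simp add: psubset_card_mono)
  qed
  show iff: "r u < r v \<longleftrightarrow> R u v" if "u \<in> V" "v \<in> V" for u v
    using that mono total by (metis less_asym less_irrefl)
  have inj: "inj_on r V"
    by (rule inj_onI) (metis iff total less_irrefl)
  have "r v \<le> card V" if "v \<in> V" for v
  proof -
    have "{u\<in>V. R u v} \<subset> V"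
      using that irrefl by blast
    then show ?thesis
      unfolding r_def using fin by (simp add: psubset_card_mono Suc_le_eq)
  qed
  then have "r ` V \<subseteq> {1..card V}"
    by (auto simp: r_def)
  moreover have "card (r ` V) = card {1..card V}"
    using inj by (simp add: card_image)
  ultimately have "r ` V = {1..card V}"
    by (simp add: card_subset_eq)
  then show "bij_betw r V {1..card V}"
    using inj by (simp add: bij_betw_def)
qed

text \<open>The positions of any listing are ranked by value, ties being broken by position, and the
  inverse of this ranking sorts the listing. The order is a parameter because
  \<open>word_less S\<close> varies with \<open>S\<close>.\<close>

lemma sorted_listing_exists:
  fixes M :: "'a multiset"
  assumes order: "transp lt" "irreflp lt" "totalp lt"
  obtains f :: "nat \<Rightarrow> 'a"
  where "image_mset f (mset_set {1..size M}) = M"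
    and "\<And>x y. x \<in> {1..size M} \<Longrightarrow> y \<in> {1..size M} \<Longrightarrow> x < y \<Longrightarrow> \<not> lt (f y) (f x)"
proof -
  obtain xs where xs: "mset xs = M"
    using ex_mset by blast
  define R where "R i j \<longleftrightarrow> lt (xs ! i) (xs ! j) \<or> xs ! i = xs ! j \<and> i < j" for i j
  have lt: "\<And>u v w. lt u v \<Longrightarrow> lt v w \<Longrightarrow> lt u w" "\<And>u. \<not> lt u u" "\<And>u v. u \<noteq> v \<Longrightarrow> lt u v \<or> lt v u"
    using order by (auto simp: transp_def irreflp_def totalp_on_def)
  obtain r where r: "bij_betw r {..<length xs} {1..length xs}"
      and r_less: "\<And>i j. i < length xs \<Longrightarrow> j < length xs \<Longrightarrow> r i < r j \<longleftrightarrow> R i j"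
    using ranking_exists[of "{..<length xs}" R]
    unfolding R_def card_lessThan lessThan_iff
    by (smt (verit, best) finite_lessThan lt nat_neq_iff order_less_trans)
  define s where "s = the_inv_into {..<length xs} r"
  have s: "bij_betw s {1..length xs} {..<length xs}"
    unfolding s_def by (rule bij_betw_the_inv_into[OF r])
  have rs: "r (s x) = x" if "x \<in> {1..length xs}" for x
    unfolding s_def using r that by (simp add: f_the_inv_into_f_bij_betw)
  have len: "size M = length xs"
    using xs by auto
  show thesis
  proof (rule that[of "\<lambda>x. xs ! s x"])
    have "image_mset (\<lambda>x. xs ! s x) (mset_set {1..length xs})
        = image_mset ((!) xs) (image_mset s (mset_set {1..length xs}))"
      by (simp add: multiset.map_comp comp_def)
    also have "\<dots> = image_mset ((!) xs) (mset_set {..<length xs})"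
      using s by (simp add: image_mset_mset_set bij_betw_def)
    also have "\<dots> = M"
      unfolding xs[symmetric] by (metis atLeast0LessThan map_nth mset_map mset_upt)
    finally show "image_mset (\<lambda>x. xs ! s x) (mset_set {1..size M}) = M"
      by (simp add: len)
  next
    fix x y
    assume xy: "x \<in> {1..size M}" "y \<in> {1..size M}" "x < y"
    then have "s x < length xs" "s y < length xs"
      using s len by (auto simp: bij_betw_def)
    with xy have "R (s x) (s y)"
      using rs len r_less by (metis (full_types))
    then show "\<not> lt (xs ! s y) (xs ! s x)"
      unfolding R_def using lt by metis
  qed
qed

section \<open>Words and the alternating lexicographic order\<close>

definition shift :: "nat \<Rightarrow> (nat \<Rightarrow> 'c) \<Rightarrow> nat \<Rightarrow> 'c" where
  "shift m w = (\<lambda>i. w (m + i))"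

lemma shift_apply [simp]: "shift m w i = w (m + i)"
  by (simp add: shift_def)

lemma shift_shift [simp]: "shift m (shift l w) = shift (l + m) w"
  by (simp add: shift_def add.assoc)

lemma shift_0 [simp]: "shift 0 w = w"
  by (simp add: shift_def)

text \<open>Phrased with \<open>filter\<close> so that it unfolds to the counts of the theorem,
  where a fundamental period or a whole necklace takes the place of the prefix.\<close>

definition sign_count :: "'c set \<Rightarrow> (nat \<Rightarrow> 'c) \<Rightarrow> nat \<Rightarrow> nat" where
  "sign_count S w d = length (filter (\<lambda>c. c \<in> S) (map w [0..<d]))"

lemma sign_count_0 [simp]: "sign_count S w 0 = 0"
  by (simp add: sign_count_def)

lemma sign_count_Suc: "sign_count S w (Suc d) = sign_count S w d + (if w d \<in> S then 1 else 0)"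
  by (simp add: sign_count_def)

lemma sign_count_add: "sign_count S w (d + e) = sign_count S w d + sign_count S (shift d w) e"
  by (induction e) (auto simp: sign_count_Suc)

lemma sign_count_cong: "(\<And>i. i < d \<Longrightarrow> u i = v i) \<Longrightarrow> sign_count S u d = sign_count S v d"
  by (induction d) (auto simp: sign_count_Suc)

text \<open>
  Every letter of \<open>S\<close> in the common prefix reverses the comparison of the first letters that differ,
  in accordance with the descents prescribed on the blocks of \<open>S\<close>.
\<close>

definition word_less :: "'c set \<Rightarrow> (nat \<Rightarrow> 'c) \<Rightarrow> (nat \<Rightarrow> 'c::linorder) \<Rightarrow> bool" where
  "word_less S u v \<longleftrightarrow>
     (\<exists>d. (\<forall>i<d. u i = v i) \<and> (if even (sign_count S u d) then u d < v d else v d < u d))"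

lemma irreflp_word_less: "irreflp (word_less S)"
  by (auto simp: irreflp_def word_less_def)

lemma totalp_word_less: "totalp (word_less S)"
proof (rule totalpI)
  fix u v :: "nat \<Rightarrow> 'a"
  assume "u \<noteq> v"
  then have ex: "\<exists>d. u d \<noteq> v d"
    by auto
  define d where "d = (LEAST d. u d \<noteq> v d)"
  have d: "u d \<noteq> v d" "\<forall>i<d. u i = v i"
    unfolding d_def using LeastI_ex[OF ex] not_less_Least by auto
  moreover from d(2) have "sign_count S u d = sign_count S v d"
    by (intro sign_count_cong) auto
  ultimately show "word_less S u v \<or> word_less S v u"
    unfolding word_less_def by (metis linorder_neqE)
qed

text \<open>The words \<open>u\<close> and \<open>w\<close> first differ at the smaller of the two
  positions of difference. All three words agree before it, so every comparison made there has the
  same direction.\<close>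

lemma transp_word_less: "transp (word_less S)"
proof (rule transpI)
  fix u v w :: "nat \<Rightarrow> 'a"
  assume "word_less S u v" "word_less S v w"
  then obtain d e
    where d: "\<forall>i<d. u i = v i" "if even (sign_count S u d) then u d < v d else v d < u d"
      and e: "\<forall>i<e. v i = w i" "if even (sign_count S v e) then v e < w e else w e < v e"
    unfolding word_less_def by auto
  define m where "m = min d e"
  have count: "sign_count S u m = sign_count S v m"
    using d(1) by (intro sign_count_cong) (auto simp: m_def)
  have "if even (sign_count S u m) then u m < w m else w m < u m"
  proof (cases d e rule: linorder_cases)
    case less
    then have "m = d" "v d = w d"
      using e(1) by (auto simp: m_def)
    then show ?thesis
      using d(2) by (simp split: if_splits)
  next
    case equal
    then have "m = d" "m = e"
      by (auto simp: m_def)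
    then show ?thesis
      using d(2) e(2) count by (metis order.strict_trans)
  next
    case greater
    then have "m = e" "u e = v e"
      using d(1) by (auto simp: m_def)
    then show ?thesis
      using e(2) count by (simp split: if_splits)
  qed
  moreover have "\<forall>i<m. u i = w i"
    using d(1) e(1) by (auto simp: m_def)
  ultimately show "word_less S u w"
    unfolding word_less_def by (intro exI[of _ m] conjI) assumption+
qed

lemma word_less_hd: "u 0 < v 0 \<Longrightarrow> word_less S u v"
  unfolding word_less_def by (intro exI[of _ 0]) auto

text \<open>Dropping a common first letter keeps the first difference and changes the parity in
  front of it exactly when that letter lies in \<open>S\<close>. This is how the order on words
  produces the prescribed ascents and descents.\<close>

lemma word_less_shift:
  assumes "word_less S u v" "u 0 = v 0"
  shows "if u 0 \<in> S then word_less S (shift 1 v) (shift 1 u) else word_less S (shift 1 u) (shift 1 v)"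
proof -
  obtain d where d: "\<forall>i<d. u i = v i" "if even (sign_count S u d) then u d < v d else v d < u d"
    using assms(1) unfolding word_less_def by auto
  have "d \<noteq> 0"
    using d(2) assms(2) by (cases d) auto
  then obtain e where e: "d = Suc e"
    using not0_implies_Suc by blast
  have "sign_count S u d = (if u 0 \<in> S then 1 else 0) + sign_count S (shift 1 u) e"
    using sign_count_add[of S u 1 e] sign_count_Suc[of S u 0] by (simp add: e)
  moreover have "sign_count S (shift 1 u) e = sign_count S (shift 1 v) e"
    using d(1) e by (intro sign_count_cong) auto
  moreover have eq: "\<forall>i<e. shift 1 u i = shift 1 v i"
    using d(1) e by auto
  ultimately have "if (u 0 \<in> S) = odd (sign_count S (shift 1 u) e)
      then shift 1 u e < shift 1 v e else shift 1 v e < shift 1 u e"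
      and "sign_count S (shift 1 u) e = sign_count S (shift 1 v) e"
    using d(2) by (simp_all add: e split: if_splits)
  then show ?thesis
    using eq unfolding word_less_def
    by (cases "u 0 \<in> S") (fastforce intro: exI[of _ e] simp del: shift_apply)+
qed

section \<open>Periods\<close>

definition is_period :: "(nat \<Rightarrow> 'c) \<Rightarrow> nat \<Rightarrow> bool" where
  "is_period w d \<longleftrightarrow> shift d w = w"

text \<open>Since \<open>0\<close> is a period of every word, positivity is required explicitly. The
  value is meaningful only for a word with some positive period, as assumed in
  \<open>is_period_iff_dvd\<close>.\<close>

definition min_period :: "(nat \<Rightarrow> 'c) \<Rightarrow> nat" where
  "min_period w = (LEAST d. d > 0 \<and> is_period w d)"

lemma is_periodD: "is_period w d \<Longrightarrow> w (d + i) = w i"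
  unfolding is_period_def using shift_apply[of d w i] by simp

lemma is_period_mult: "is_period w d \<Longrightarrow> is_period w (d * r)"
proof (induction r)
  case (Suc r)
  then have "shift (d * r) (shift d w) = w"
    by (simp add: is_period_def del: shift_shift)
  then show ?case
    by (simp add: is_period_def)
qed (simp add: is_period_def)

lemma is_period_shift: "is_period w d \<Longrightarrow> is_period (shift m w) d"
proof -
  assume "is_period w d"
  then have "shift m (shift d w) = shift m w"
    by (simp add: is_period_def del: shift_shift)
  then show ?thesis
    by (simp add: is_period_def add.commute)
qed

lemma is_period_mod:
  assumes "is_period w d" shows "w (i mod d) = w i"
  using is_periodD[OF is_period_mult[OF assms], of "i div d" "i mod d"] by simp

lemma min_period:
  assumes "is_period w d" "d > 0"
  shows "min_period w > 0" "is_period w (min_period w)"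
  using LeastI[of "\<lambda>d. d > 0 \<and> is_period w d" d] assms unfolding min_period_def by auto

text \<open>The remainder of a period modulo the minimal one is again a period, so by minimality it
  is zero.\<close>

lemma is_period_iff_dvd:
  assumes "is_period w d" "d > 0"
  shows "is_period w m \<longleftrightarrow> min_period w dvd m"
proof
  assume m: "is_period w m"
  let ?p = "min_period w"
  note p = min_period[OF assms]
  have "w (m mod ?p + i) = w i" for i
  proof -
    have "w (m mod ?p + i) = w (?p * (m div ?p) + (m mod ?p + i))"
      using is_periodD[OF is_period_mult[OF p(2)], of "m div ?p" "m mod ?p + i"] by simp
    also have "?p * (m div ?p) + (m mod ?p + i) = m + i"
      by simp
    also have "w (m + i) = w i"
      by (rule is_periodD[OF m])
    finally show ?thesis .
  qed
  then have "is_period w (m mod ?p)"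
    by (auto simp: is_period_def)
  moreover have "m mod ?p < ?p"
    using p by simp
  ultimately have "m mod ?p = 0"
    using not_less_Least[of "m mod ?p" "\<lambda>d. d > 0 \<and> is_period w d"] by (simp add: min_period_def)
  then show "?p dvd m"
    by auto
next
  assume "min_period w dvd m"
  then show "is_period w m"
    using is_period_mult[OF min_period(2)[OF assms]] by auto
qed

lemma sign_count_mult:
  assumes "is_period w d"
  shows "sign_count S w (d * r) = sign_count S w d * r"
proof (induction r)
  case (Suc r)
  have "sign_count S w (d + d * r) = sign_count S w d + sign_count S w (d * r)"
    using assms by (simp add: sign_count_add is_period_def)
  then show ?case
    using Suc by (simp add: add.commute)
qed simp

text \<open>The first letter, which the shift removes, recurs at the positive position
  \<open>d * e\<close>, a common period of both words.\<close>

lemma shift_inj_periodic: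
  assumes "is_period u d" "d > 0" "is_period v e" "e > 0" "shift 1 u = shift 1 v"
  shows "u = v"
proof
  fix i
  have "u (d * e + i) = v (d * e + i)"
    using fun_cong[OF assms(5), of "d * e + i - 1"] assms(2,4) by simp
  moreover have "u (d * e + i) = u i" "v (d * e + i) = v i"
    using is_periodD[OF is_period_mult[OF assms(1)], of e] is_periodD[OF is_period_mult[OF assms(3)], of d]
    by (simp_all add: mult.commute)
  ultimately show "u i = v i"
    by simp
qed

section \<open>The words of a necklace\<close>

text \<open>One infinite word for each starting vertex, read around the cycle forever. Repetitions
  are kept: an \<open>r\<close>-repeating necklace yields each of its words \<open>r\<close>
  times.\<close>

definition cyclic_words :: "'c list \<Rightarrow> (nat \<Rightarrow> 'c) list" where
  "cyclic_words xs = map (\<lambda>m i. xs ! ((m + i) mod length xs)) [0..<length xs]"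

lemma length_cyclic_words [simp]: "length (cyclic_words xs) = length xs"
  by (simp add: cyclic_words_def)

lemma cyclic_words_rotate: "cyclic_words (rotate j xs) = rotate j (cyclic_words xs)"
proof (rule nth_equalityI)
  fix m assume "m < length (cyclic_words (rotate j xs))"
  then have m: "m < length xs" by simp
  then have pos: "0 < length xs" by linarith
  show "cyclic_words (rotate j xs) ! m = rotate j (cyclic_words xs) ! m"
  proof
    fix i
    show "(cyclic_words (rotate j xs) ! m) i = (rotate j (cyclic_words xs) ! m) i"
      using m pos by (simp add: nth_rotate cyclic_words_def mod_simps ac_simps)
  qed
qed simp

lemma mset_rotate: "mset (rotate j xs) = mset xs"
  by (metis append_take_drop_id mset_append rotate_drop_take union_commute)

lift_definition necklace_words :: "'c necklace \<Rightarrow> (nat \<Rightarrow> 'c) multiset"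
  is "\<lambda>xs. mset (cyclic_words xs)"
  by (auto simp: rotation_of_def cyclic_words_rotate mset_rotate)

lemma necklace_of_eq_iff: "necklace_of xs = necklace_of ys \<longleftrightarrow> (\<exists>m. ys = rotate m xs)"
  by transfer (simp add: rotation_of_def)

lemma necklace_cases: obtains xs where "N = necklace_of xs"
  by (metis Quotient_abs_rep[OF Quotient_necklace] necklace_of.abs_eq)

lemma necklace_words_of [simp]: "necklace_words (necklace_of xs) = mset (cyclic_words xs)"
  by transfer simp

lemma necklace_length_of [simp]: "necklace_length (necklace_of xs) = length xs"
  by transfer simp

lemma necklace_entries_of [simp]: "necklace_entries (necklace_of xs) = mset xs"
  by transfer simp

lemma recolor_of [simp]: "recolor f (necklace_of xs) = necklace_of (map f xs)"
  by transfer (simp add: equivp_reflp[OF equivp_rotation_of])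

lemma size_necklace_words [simp]: "size (necklace_words N) = necklace_length N"
  by (cases N rule: necklace_cases) simp

lemma cyclic_words_map:
  assumes "is_period w L"
  shows "cyclic_words (map w [0..<L]) = map (\<lambda>m. shift m w) [0..<L]"
  unfolding cyclic_words_def using assms
  by (auto simp: fun_eq_iff is_period_mod nth_append)

text \<open>The letters of a word during one turn form a rotation of the representative. Hence any
  one word together with the length recovers the necklace.\<close>

lemma necklace_wordD:
  assumes "w \<in># necklace_words N"
  shows "necklace_length N > 0" "is_period w (necklace_length N)"
    "N = necklace_of (map w [0..<necklace_length N])"
proof -
  obtain xs where N: "N = necklace_of xs"
    by (rule necklace_cases)
  with assms obtain m where m: "m < length xs" "w = (\<lambda>i. xs ! ((m + i) mod length xs))"
    by (auto simp: cyclic_words_def)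
  then show "necklace_length N > 0"
    by (auto simp: N)
  have "(m + (length xs + i)) mod length xs = (m + i) mod length xs" for i
    by (metis add.assoc add.commute mod_add_self2)
  then show "is_period w (necklace_length N)"
    by (auto simp: N is_period_def m(2))
  have "map w [0..<length xs] = rotate m xs"
    by (rule nth_equalityI) (simp_all add: m(2) nth_rotate)
  then show "N = necklace_of (map w [0..<necklace_length N])"
    unfolding N necklace_of_eq_iff by (auto simp: N)
qed

lemma necklace_words_eq:
  assumes "w \<in># necklace_words N"
  shows "necklace_words N = mset (map (\<lambda>m. shift m w) [0..<necklace_length N])"
  using necklace_wordD[OF assms] by (metis cyclic_words_map necklace_words_of)

lemma word_in_necklace_of:
  assumes "is_period w L" "L > 0"
  shows "w \<in># necklace_words (necklace_of (map w [0..<L]))"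
  using assms by (auto simp: cyclic_words_map intro!: image_eqI[of _ _ 0])

lemma necklace_word_exists:
  assumes "necklace_length N > 0" obtains w where "w \<in># necklace_words N"
  using assms size_necklace_words[of N] by (metis less_numeral_extra(3) multiset_nonemptyE size_empty)

lemma necklace_word_min_period:
  assumes "w \<in># necklace_words N"
  shows "min_period w > 0" "is_period w (min_period w)" "min_period w dvd necklace_length N"
  using necklace_wordD[OF assms] min_period is_period_iff_dvd by blast+

text \<open>The starting vertices that read the same word as a given one are those at a distance
  divisible by the minimal period.\<close>

lemma count_necklace_words:
  assumes "w \<in># necklace_words N"
  shows "min_period w * count (necklace_words N) w = necklace_length N"
proof -
  let ?p = "min_period w" and ?L = "necklace_length N"
  note p = necklace_word_min_period[OF assms]
  obtain r where r: "?L = ?p * r"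
    using p(3) by auto
  have "count (necklace_words N) w = card {m. m < ?L \<and> w = shift m w}"
    unfolding necklace_words_eq[OF assms] count_mset count_list_eq_length_filter length_filter_conv_card
    by (simp cong: conj_cong)
  also have "{m. m < ?L \<and> w = shift m w} = {m. m < ?p * r \<and> ?p dvd m}"
    using is_period_iff_dvd[OF p(2,1)] unfolding r is_period_def by metis
  also have "\<dots> = (\<lambda>j. ?p * j) ` {..<r}"
    using p(1) by (auto elim!: dvdE)
  also have "card \<dots> = r"
    using p(1) by (subst card_image) (auto intro: inj_onI)
  finally show ?thesis
    by (simp add: r)
qed

section \<open>Powers of blocks, fundamental periods and repetition numbers\<close>

lemma replicate_map_period:
  assumes "is_period w p"
  shows "concat (replicate r (map w [0..<p])) = map w [0..<p * r]"
proof (induction r)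
  case (Suc r)
  have "map w [0..<p + p * r] = map w [0..<p] @ map w [p..<p + p * r]"
    by (simp add: upt_add_eq_append[of 0 p "p * r", simplified])
  also have "map w [p..<p + p * r] = map w [0..<p * r]"
    by (rule nth_equalityI) (simp_all add: is_periodD[OF assms])
  finally show ?case
    using Suc by simp
qed simp

lemma power_necklace_word:
  assumes "N = necklace_of (concat (replicate r Q))" "necklace_length N > 0"
  obtains w where "w \<in># necklace_words N" "is_period w (length Q)" "Q = map w [0..<length Q]"
    "length Q > 0"
proof -
  have len: "length (concat (replicate r Q)) = length Q * r"
    by (induction r) auto
  then have pos: "length Q > 0" "r > 0"
    using assms by auto
  define w where "w i = Q ! (i mod length Q)" for i
  have w: "is_period w (length Q)"
    by (auto simp: is_period_def w_def)
  have Q: "Q = map w [0..<length Q]"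
    by (rule nth_equalityI) (auto simp: w_def)
  have "concat (replicate r Q) = map w [0..<length Q * r]"
    using replicate_map_period[OF w] Q by metis
  then have "w \<in># necklace_words N"
    using word_in_necklace_of[OF is_period_mult[OF w]] pos assms(1) by simp
  then show thesis
    using that w Q pos by blast
qed

lemma necklace_words_shift:
  assumes "v \<in># necklace_words N" "w \<in># necklace_words N"
  obtains m where "v = shift m w"
  using assms(1) that unfolding necklace_words_eq[OF assms(2)] by auto

lemma necklace_of_word_power:
  assumes "w \<in># necklace_words N"
  shows "\<exists>r. N = necklace_of (concat (replicate r (map w [0..<min_period w])))"
  using necklace_word_min_period[OF assms] necklace_wordD(3)[OF assms]
    replicate_map_period[of w "min_period w"] by (metis dvdE)

text \<open>A block whose power is \<open>N\<close> extends periodically to a word of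
  \<open>N\<close>, so it is at least as long as the minimal period of that word. The initial
  segments of this minimal length attain the bound, one for each word, which accounts for all
  rotations of the period.\<close>

lemma fundamental_period_iff:
  assumes "necklace_length N > 0"
  shows "fundamental_period N P \<longleftrightarrow> (\<exists>w. w \<in># necklace_words N \<and> P = map w [0..<min_period w])"
    (is "_ \<longleftrightarrow> ?R")
proof
  assume P: "fundamental_period N P"
  then obtain r where "N = necklace_of (concat (replicate r P))"
    unfolding fundamental_period_def is_arg_min_def by auto
  then obtain w where w: "w \<in># necklace_words N" "is_period w (length P)" "P = map w [0..<length P]"
      "length P > 0"
    using power_necklace_word[OF _ assms] by blast
  have "\<not> length (map w [0..<min_period w]) < length P"
    using P necklace_of_word_power[OF w(1)] unfolding fundamental_period_def is_arg_min_def by blast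
  moreover have "min_period w \<le> length P"
    using w(2,4) is_period_iff_dvd[of w "length P" "length P"] dvd_imp_le by blast
  ultimately have "length P = min_period w"
    by simp
  then show ?R
    using w(1,3) by auto
next
  assume ?R
  then obtain w where w: "w \<in># necklace_words N" "P = map w [0..<min_period w]"
    by auto
  have "\<not> length Q < length P" if Q: "N = necklace_of (concat (replicate r Q))" for r Q
  proof -
    obtain v where v: "v \<in># necklace_words N" "is_period v (length Q)" "length Q > 0"
      using power_necklace_word[OF Q assms] by blast
    obtain m where "w = shift m v"
      by (rule necklace_words_shift[OF w(1) v(1)])
    then have "is_period w (length Q)"
      by (simp add: v is_period_shift)
    then have "min_period w \<le> length Q"
      using v(3) is_period_iff_dvd[of w "length Q" "length Q"] dvd_imp_le by blast
    then show ?thesis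
      by (simp add: w)
  qed
  then show "fundamental_period N P"
    using necklace_of_word_power[OF w(1)] unfolding fundamental_period_def is_arg_min_def w(2) by blast
qed

text \<open>Any two words of a necklace are shifts of each other, and shifting preserves periods, so
  the two minimal periods divide each other.\<close>

lemma min_period_necklace_eq:
  assumes "v \<in># necklace_words N" "w \<in># necklace_words N"
  shows "min_period v = min_period w"
proof -
  have "min_period x dvd min_period y" if x: "x \<in># necklace_words N" and y: "y \<in># necklace_words N" for x y
  proof -
    obtain m where "x = shift m y"
      by (rule necklace_words_shift[OF x y])
    then have "is_period x (min_period y)"
      using is_period_shift necklace_word_min_period(2)[OF y] by auto
    then show ?thesis
      using is_period_iff_dvd necklace_wordD(1,2)[OF x] by blast
  qed
  then show ?thesis
    using assms by (simp add: dvd_antisym)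
qed

text \<open>All fundamental periods of \<open>N\<close> have the same length, so the repetition
  number can be read off from the length of \<open>N\<close>.\<close>

lemma repeating_iff:
  assumes "w \<in># necklace_words N"
  shows "repeating r N \<longleftrightarrow> necklace_length N = min_period w * r"
proof
  assume "repeating r N"
  then obtain v where v: "v \<in># necklace_words N"
      "N = necklace_of (concat (replicate r (map v [0..<min_period v])))"
    unfolding repeating_def using fundamental_period_iff necklace_wordD(1)[OF assms] by metis
  then have "N = necklace_of (map v [0..<min_period v * r])"
    using replicate_map_period[OF necklace_word_min_period(2)[OF v(1)]] by simp
  then have "necklace_length N = min_period v * r"
    by (metis diff_zero length_map length_upt necklace_length_of)
  then show "necklace_length N = min_period w * r"
    using min_period_necklace_eq[OF assms v(1)] by simp
next
  assume "necklace_length N = min_period w * r"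
  then have "N = necklace_of (concat (replicate r (map w [0..<min_period w])))"
    using necklace_wordD(3)[OF assms] replicate_map_period[OF necklace_word_min_period(2)[OF assms]]
    by metis
  then show "repeating r N"
    unfolding repeating_def using fundamental_period_iff necklace_wordD(1)[OF assms] assms by metis
qed

lemma size_filter_necklace_entries:
  assumes "w \<in># necklace_words N"
  shows "size (filter_mset (\<lambda>c. c \<in> S) (necklace_entries N)) = sign_count S w (necklace_length N)"
  using necklace_wordD(3)[OF assms]
  by (metis mset_filter necklace_entries_of sign_count_def size_mset)

lemma image_hd_necklace_words: "image_mset (\<lambda>w. w 0) (necklace_words N) = necklace_entries N"
proof (cases N rule: necklace_cases)
  case (1 xs)
  have "map (\<lambda>w. w 0) (cyclic_words xs) = xs"
    by (rule nth_equalityI) (auto simp: cyclic_words_def)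
  then show ?thesis
    using 1 by (metis mset_map necklace_entries_of necklace_words_of)
qed

text \<open>Shifting a word moves its starting vertex one step ahead, which only rotates the list of
  words. This invariance, multiplicities included, is what allows a permutation to be built from the
  words.\<close>

lemma image_shift_necklace_words: "image_mset (shift 1) (necklace_words N) = necklace_words N"
proof (cases N rule: necklace_cases)
  case (1 xs)
  have "Suc i mod length xs < length xs" if "i < length xs" for i
    using that by (cases "xs = []") auto
  then have "map (shift 1) (cyclic_words xs) = rotate 1 (cyclic_words xs)"
    by (intro nth_equalityI) (auto simp: cyclic_words_def nth_rotate1 fun_eq_iff mod_simps)
  then show ?thesis
    using 1 by (metis mset_map mset_rotate necklace_words_of)
qed

section \<open>Admissible ornaments\<close>

definition ornament_words :: "'c necklace multiset \<Rightarrow> (nat \<Rightarrow> 'c) multiset" where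
  "ornament_words \<Omega> = (\<Sum>N\<in>#\<Omega>. necklace_words N)"

text \<open>The three conditions of the theorem, translated into statements about minimal periods
  and sign counts of words.\<close>

definition admissible :: "'c set \<Rightarrow> 'c necklace multiset \<Rightarrow> bool" where
  "admissible S \<Omega> \<longleftrightarrow> (\<forall>N\<in>#\<Omega>. \<forall>w\<in>#necklace_words N.
     (even (sign_count S w (min_period w)) \<longrightarrow> necklace_length N = min_period w) \<and>
     (odd (sign_count S w (min_period w)) \<longrightarrow>
       necklace_length N = min_period w \<or> necklace_length N = min_period w * 2) \<and>
     (odd (sign_count S w (necklace_length N)) \<longrightarrow> count \<Omega> N = 1))"

lemma admissible_iff:
  assumes "\<And>N. N \<in># \<Omega> \<Longrightarrow> necklace_length N > 0"
  shows "admissible S \<Omega> \<longleftrightarrow>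
    (\<forall>N\<in>#\<Omega>. \<forall>P. fundamental_period N P \<and> even (length (filter (\<lambda>c. c \<in> S) P)) \<longrightarrow> repeating 1 N) \<and>
    (\<forall>N\<in>#\<Omega>. \<forall>P. fundamental_period N P \<and> odd (length (filter (\<lambda>c. c \<in> S) P)) \<longrightarrow>
       repeating 1 N \<or> repeating 2 N) \<and>
    (\<forall>N\<in>#\<Omega>. odd (size (filter_mset (\<lambda>c. c \<in> S) (necklace_entries N))) \<longrightarrow> count \<Omega> N = 1)"
proof -
  have even: "(\<forall>P. fundamental_period N P \<and> even (length (filter (\<lambda>c. c \<in> S) P)) \<longrightarrow> repeating 1 N) \<longleftrightarrow>
      (\<forall>w\<in>#necklace_words N. even (sign_count S w (min_period w)) \<longrightarrow> necklace_length N = min_period w)"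
    if "N \<in># \<Omega>" for N
    unfolding fundamental_period_iff[OF assms[OF that]] sign_count_def
    by (auto simp: repeating_iff)
  have odd: "(\<forall>P. fundamental_period N P \<and> odd (length (filter (\<lambda>c. c \<in> S) P)) \<longrightarrow>
        repeating 1 N \<or> repeating 2 N) \<longleftrightarrow>
      (\<forall>w\<in>#necklace_words N. odd (sign_count S w (min_period w)) \<longrightarrow>
        necklace_length N = min_period w \<or> necklace_length N = min_period w * 2)"
    if "N \<in># \<Omega>" for N
    unfolding fundamental_period_iff[OF assms[OF that]] sign_count_def
    by (auto simp: repeating_iff)
  have entries: "(odd (size (filter_mset (\<lambda>c. c \<in> S) (necklace_entries N))) \<longrightarrow> count \<Omega> N = 1) \<longleftrightarrow>
      (\<forall>w\<in>#necklace_words N. odd (sign_count S w (necklace_length N)) \<longrightarrow> count \<Omega> N = 1)"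
    if "N \<in># \<Omega>" for N
    using necklace_word_exists[OF assms[OF that]] size_filter_necklace_entries[of _ N S] by metis
  show ?thesis
    unfolding admissible_def ball_conj_distrib by (simp only: even odd entries cong: ball_cong)
qed

lemma count_sum_mset_image: "count (\<Sum>N\<in>#\<Omega>. f N) w = (\<Sum>N\<in>#\<Omega>. count (f N) w)"
  by (induction \<Omega>) auto

text \<open>A necklace having the word \<open>w\<close> is determined by its length, which
  admissibility limits to one or two minimal periods. It then has \<open>w\<close> once or twice,
  respectively.\<close>

lemma count_ornament_words:
  assumes adm: "admissible S \<Omega>" and w: "is_period w d" "d > 0"
  defines "M \<equiv> \<lambda>r. necklace_of (map w [0..<min_period w * r])"
  shows "count (ornament_words \<Omega>) w = count \<Omega> (M 1) + 2 * count \<Omega> (M 2)"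
    and "even (sign_count S w (min_period w)) \<Longrightarrow> count \<Omega> (M 2) = 0"
    and "odd (sign_count S w (min_period w)) \<Longrightarrow> count \<Omega> (M 1) \<le> 1"
proof -
  let ?p = "min_period w"
  note p = min_period[OF w]
  have M: "w \<in># necklace_words (M r)" "necklace_length (M r) = ?p * r" if "r > 0" for r
    unfolding M_def using word_in_necklace_of[OF is_period_mult[OF p(2)]] p(1) that by simp_all
  have neq: "M 1 \<noteq> M 2"
    using M(2)[of 1] M(2)[of 2] p(1) by auto
  have "count (necklace_words N) w = (if N = M 1 then 1 else if N = M 2 then 2 else 0)"
    if N: "N \<in># \<Omega>" for N
  proof (cases "w \<in># necklace_words N")
    case True
    have "necklace_length N = ?p * 1 \<or> necklace_length N = ?p * 2"
      using adm N True unfolding admissible_def by (metis mult_1_right)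
    then have "N = M 1 \<or> N = M 2"
      unfolding M_def using necklace_wordD(3)[OF True] by metis
    then show ?thesis
      using count_necklace_words[OF True] M(2)[of 1] M(2)[of 2] p(1) neq by auto
  next
    case False
    then have "N \<noteq> M 1" "N \<noteq> M 2"
      using M(1)[of 1] M(1)[of 2] by auto
    then show ?thesis
      using False by (simp add: not_in_iff)
  qed
  then have "(\<Sum>N\<in>#\<Omega>. count (necklace_words N) w) =
      (\<Sum>N\<in>#\<Omega>. if N = M 1 then 1 else if N = M 2 then 2 else 0)"
    by (intro arg_cong[where f = sum_mset] image_mset_cong) auto
  also have "\<dots> = count \<Omega> (M 1) + 2 * count \<Omega> (M 2)"
    using neq by (induction \<Omega>) auto
  finally show "count (ornament_words \<Omega>) w = count \<Omega> (M 1) + 2 * count \<Omega> (M 2)"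
    by (simp add: ornament_words_def count_sum_mset_image)
  show "count \<Omega> (M 2) = 0" if "even (sign_count S w ?p)"
  proof (rule ccontr)
    assume "count \<Omega> (M 2) \<noteq> 0"
    then have "M 2 \<in># \<Omega>"
      by (simp add: count_eq_zero_iff)
    then have "necklace_length (M 2) = ?p"
      using adm M(1)[of 2] that unfolding admissible_def by simp
    then show False
      using M(2)[of 2] p(1) by simp
  qed
  show "count \<Omega> (M 1) \<le> 1" if "odd (sign_count S w ?p)"
  proof (cases "M 1 \<in># \<Omega>")
    case True
    moreover have "necklace_length (M 1) = ?p"
      using M(2)[of 1] by simp
    ultimately have "count \<Omega> (M 1) = 1"
      using adm M(1)[of 1] that unfolding admissible_def by simp
    then show ?thesis by simp
  qed (simp add: not_in_iff)
qed

text \<open>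
  Among the powers of one primitive word, only the first and the second can occur. If its
  number of letters in \<open>S\<close> is even, only the first does; if it is odd, the multiplicity of the first is the parity of the number
  of vertices reading the word.
\<close>

lemma admissible_eqI:
  assumes adm: "admissible S \<Omega>" "admissible S \<Omega>'"
    and pos: "\<And>N. N \<in># \<Omega> + \<Omega>' \<Longrightarrow> necklace_length N > 0"
    and eq: "ornament_words \<Omega> = ornament_words \<Omega>'"
  shows "\<Omega> = \<Omega>'"
proof (rule multiset_eqI)
  fix N
  show "count \<Omega> N = count \<Omega>' N"
  proof (cases "N \<in># \<Omega> + \<Omega>'")
    case True
    obtain w where w: "w \<in># necklace_words N"
      using necklace_word_exists[OF pos[OF True]] .
    define M where "M r = necklace_of (map w [0..<min_period w * r])" for r
    note per = necklace_wordD(2,1)[OF w]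
    note 1 = count_ornament_words[OF adm(1) per, folded M_def]
    note 2 = count_ornament_words[OF adm(2) per, folded M_def]
    have "necklace_length N = min_period w * 1 \<or> necklace_length N = min_period w * 2"
      using adm True w unfolding admissible_def by (metis mult_1_right union_iff)
    then have "N = M 1 \<or> N = M 2"
      unfolding M_def using necklace_wordD(3)[OF w] by metis
    moreover have "count \<Omega> (M 1) = count \<Omega>' (M 1) \<and> count \<Omega> (M 2) = count \<Omega>' (M 2)"
    proof (cases "even (sign_count S w (min_period w))")
      case True
      then show ?thesis
        using 1(1) 1(2)[OF True] 2(1) 2(2)[OF True] eq by simp
    next
      case False
      have "count \<Omega> (M 1) + 2 * count \<Omega> (M 2) = count \<Omega>' (M 1) + 2 * count \<Omega>' (M 2)"
        using 1(1) 2(1) eq by simp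
      then show ?thesis
        using 1(3)[OF False] 2(3)[OF False] by presburger
    qed
    ultimately show ?thesis
      by auto
  next
    case False
    then show ?thesis
      by (auto simp: not_in_iff)
  qed
qed

section \<open>The words along the orbits of a permutation\<close>

definition orbit_word :: "('a \<Rightarrow> 'c) \<Rightarrow> ('a \<Rightarrow> 'a) \<Rightarrow> 'a \<Rightarrow> nat \<Rightarrow> 'c" where
  "orbit_word f \<pi> x = (\<lambda>i. f ((\<pi> ^^ i) x))"

lemma shift_orbit_word: "shift m (orbit_word f \<pi> x) = orbit_word f \<pi> ((\<pi> ^^ m) x)"
  by (auto simp: orbit_word_def fun_eq_iff funpow_add add.commute[of m])

lemma support_props:
  assumes "permutation \<pi>"
  shows "distinct (support \<pi> x)" "set (support \<pi> x) = orbit \<pi> x" "card (orbit \<pi> x) = least_power \<pi> x"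
proof -
  show d: "distinct (support \<pi> x)"
    using cycle_of_permutation[OF assms] .
  show s: "set (support \<pi> x) = orbit \<pi> x"
    unfolding support_set[OF assms] orbit_altdef_permutation[OF assms] by auto
  show "card (orbit \<pi> x) = least_power \<pi> x"
    using distinct_card[OF d] unfolding s by simp
qed

lemma orbit_eq_iff:
  assumes "permutation \<pi>"
  shows "orbit \<pi> x = orbit \<pi> y \<longleftrightarrow> y \<in> orbit \<pi> x"
  using assms by (metis cyclic_on_orbit' orbit_cyclic_eq3 permutation_self_in_orbit)

text \<open>The uncoloured necklace of a cycle has the orbit as its set of entries, and starting the
  cycle at \<open>(\<pi> ^^ m) x\<close> instead of \<open>x\<close> rotates it by \<open>m\<close>.
  So the set \<open>disjoint_cycles\<close> contains exactly one necklace per orbit.\<close>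

lemma necklace_of_support_eq_iff:
  assumes "permutation \<pi>"
  shows "necklace_of (support \<pi> x) = necklace_of (support \<pi> y) \<longleftrightarrow> orbit \<pi> x = orbit \<pi> y"
proof
  assume "necklace_of (support \<pi> x) = necklace_of (support \<pi> y)"
  then have "mset (support \<pi> x) = mset (support \<pi> y)"
    by (metis necklace_entries_of)
  then show "orbit \<pi> x = orbit \<pi> y"
    unfolding support_props(2)[OF assms, symmetric] by (rule mset_eq_setD)
next
  assume eq: "orbit \<pi> x = orbit \<pi> y"
  then have "y \<in> orbit \<pi> x"
    using permutation_self_in_orbit[OF assms] by auto
  then obtain m where m: "y = (\<pi> ^^ m) x"
    unfolding orbit_altdef by auto
  have len: "least_power \<pi> x = least_power \<pi> y"
    using eq support_props(3)[OF assms] by metis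
  have "support \<pi> y = rotate m (support \<pi> x)"
  proof (rule nth_equalityI)
    fix i assume "i < length (support \<pi> y)"
    then have i: "i < least_power \<pi> x"
      using len by simp
    have "(\<pi> ^^ i) y = (\<pi> ^^ (m + i)) x"
      by (simp add: m funpow_add add.commute[of m])
    also have "\<dots> = (\<pi> ^^ ((m + i) mod least_power \<pi> x)) x"
      using funpow_mod_eq[OF least_power_of_permutation(1)[OF assms]] by metis
    finally show "support \<pi> y ! i = rotate m (support \<pi> x) ! i"
      using i len by (simp add: nth_rotate)
  qed (use len in simp)
  then show "necklace_of (support \<pi> x) = necklace_of (support \<pi> y)"
    unfolding necklace_of_eq_iff by blast
qed

lemma necklace_words_support:
  assumes "permutation \<pi>"
  shows "necklace_words (necklace_of (map f (support \<pi> x))) =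
    image_mset (orbit_word f \<pi>) (mset_set (orbit \<pi> x))"
proof -
  have "cyclic_words (map f (support \<pi> x)) = map (orbit_word f \<pi>) (support \<pi> x)"
  proof (rule nth_equalityI)
    fix m assume "m < length (cyclic_words (map f (support \<pi> x)))"
    then have m: "m < least_power \<pi> x"
      by simp
    have "(\<pi> ^^ ((m + i) mod least_power \<pi> x)) x = (\<pi> ^^ i) ((\<pi> ^^ m) x)" for i
      using funpow_mod_eq[OF least_power_of_permutation(1)[OF assms]]
      by (metis add.commute comp_apply funpow_add)
    then show "cyclic_words (map f (support \<pi> x)) ! m = map (orbit_word f \<pi>) (support \<pi> x) ! m"
      using m by (auto simp: cyclic_words_def orbit_word_def fun_eq_iff)
  qed simp
  then have "necklace_words (necklace_of (map f (support \<pi> x)))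
      = image_mset (orbit_word f \<pi>) (mset (support \<pi> x))"
    by (simp del: map_map)
  also have "mset (support \<pi> x) = mset_set (orbit \<pi> x)"
    using support_props[OF assms] by (metis mset_set_set)
  finally show ?thesis .
qed

lemma image_mset_mset_set_Union:
  assumes "finite F" "\<And>A. A \<in> F \<Longrightarrow> finite A" "disjoint F"
  shows "image_mset f (mset_set (\<Union>F)) = (\<Sum>A\<in>F. image_mset f (mset_set A))"
  using assms
proof (induction F rule: finite_induct)
  case (insert A F)
  then have "A \<inter> \<Union>F = {}"
    by (auto simp: disjoint_def)
  moreover have "disjoint F"
    using insert.prems(2) by (auto simp: disjoint_def)
  ultimately show ?case
    using insert by (simp add: mset_set_Union)
qed simp

lemma permutes_atLeastAtMost_permutation: "\<pi> permutes {1..n::nat} \<Longrightarrow> permutation \<pi>"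
  by (auto simp: permutation_permutes)

lemma mset_set_disjoint_cycles:
  assumes "\<pi> permutes {1..n}"
  shows "image_mset (\<lambda>N. set_mset (necklace_entries N)) (mset_set (disjoint_cycles n \<pi>))
    = mset_set (orbit \<pi> ` {1..n})"
proof -
  note perm = permutes_atLeastAtMost_permutation[OF assms]
  have entries: "set_mset (necklace_entries (necklace_of (support \<pi> x))) = orbit \<pi> x" for x
    by (metis necklace_entries_of set_mset_mset support_props(2)[OF perm])
  then have "inj_on (\<lambda>N. set_mset (necklace_entries N)) (disjoint_cycles n \<pi>)"
    unfolding disjoint_cycles_def by (auto simp: inj_on_def necklace_of_support_eq_iff[OF perm] simp del: necklace_entries_of)
  then show ?thesis
    by (simp add: image_mset_mset_set disjoint_cycles_def image_image entries del: necklace_entries_of)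
qed

lemma cycle_lengths_ornament_of:
  assumes "\<pi> permutes {1..n}"
  shows "image_mset necklace_length (ornament_of n k a \<pi>) = cycle_lengths n \<pi>"
proof -
  note perm = permutes_atLeastAtMost_permutation[OF assms]
  have "necklace_length (recolor (block_index a k) N) = card (set_mset (necklace_entries N))"
    if d: "N \<in> disjoint_cycles n \<pi>" for N
  proof -
    obtain x where N: "N = necklace_of (support \<pi> x)"
      using d unfolding disjoint_cycles_def by auto
    show ?thesis
      unfolding N recolor_of necklace_length_of necklace_entries_of set_mset_mset
      using support_props[OF perm] by (metis length_map distinct_card)
  qed
  moreover have "finite (disjoint_cycles n \<pi>)"
    by (simp add: disjoint_cycles_def)
  ultimately show ?thesis
    unfolding ornament_of_def cycle_lengths_def mset_set_disjoint_cycles[OF assms, symmetric]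
    by (auto simp: multiset.map_comp intro!: image_mset_cong)
qed

text \<open>The orbits partition \<open>{1..n}\<close>, and the necklace of an orbit contributes the
  words of its points. Thus the ornament records the multiset of the words of all points.\<close>

lemma ornament_words_ornament_of:
  assumes "\<pi> permutes {1..n}"
  shows "ornament_words (ornament_of n k a \<pi>) =
    image_mset (orbit_word (block_index a k) \<pi>) (mset_set {1..n})"
proof -
  note perm = permutes_atLeastAtMost_permutation[OF assms]
  let ?g = "\<lambda>A. image_mset (orbit_word (block_index a k) \<pi>) (mset_set A)"
  have words: "necklace_words (recolor (block_index a k) N) = ?g (set_mset (necklace_entries N))"
    if d: "N \<in> disjoint_cycles n \<pi>" for N
  proof -
    obtain x where N: "N = necklace_of (support \<pi> x)"
      using d unfolding disjoint_cycles_def by auto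
    show ?thesis
      unfolding N recolor_of necklace_words_support[OF perm] necklace_entries_of set_mset_mset
        support_props(2)[OF perm] ..
  qed
  have fin: "finite (disjoint_cycles n \<pi>)"
    by (simp add: disjoint_cycles_def)
  have sub: "orbit \<pi> x \<subseteq> {1..n}" if "x \<in> {1..n}" for x
    using permutes_orbit_subset[OF assms that] .
  have union: "\<Union> (orbit \<pi> ` {1..n}) = {1..n}"
    using sub permutation_self_in_orbit[OF perm] by blast
  have disj: "disjoint (orbit \<pi> ` {1..n})"
    using orbit_eq_iff[OF perm] unfolding disjoint_def by blast
  have "ornament_words (ornament_of n k a \<pi>)
      = (\<Sum>N\<in>#mset_set (disjoint_cycles n \<pi>). ?g (set_mset (necklace_entries N)))"
    unfolding ornament_words_def ornament_of_def multiset.map_comp comp_def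
    by (intro arg_cong[where f = sum_mset] image_mset_cong) (simp add: words fin)
  also have "\<dots> = (\<Sum>A\<in>#mset_set (orbit \<pi> ` {1..n}). ?g A)"
    unfolding mset_set_disjoint_cycles[OF assms, symmetric] multiset.map_comp comp_def ..
  also have "\<dots> = (\<Sum>A\<in>orbit \<pi> ` {1..n}. ?g A)"
    by (simp add: sum_unfold_sum_mset)
  also have "\<dots> = ?g (\<Union> (orbit \<pi> ` {1..n}))"
    by (intro image_mset_mset_set_Union[symmetric] disj)
      (auto intro: finite_orbit permutation_self_in_orbit[OF perm])
  finally show ?thesis
    unfolding union .
qed

section \<open>Permutations with prescribed ascents and descents\<close>

lemma mem_block_iff: "x \<in> block a i \<longleftrightarrow> (\<Sum>j\<in>{1..<i}. a j) < x \<and> x \<le> (\<Sum>j\<in>{1..i}. a j)"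
  by (auto simp: block_def)

lemma block_mono:
  assumes "x \<in> block a i" "y \<in> block a j" "x \<le> y"
  shows "i \<le> j"
proof (rule ccontr)
  assume "\<not> i \<le> j"
  then have "(\<Sum>l\<in>{1..j}. a l) \<le> (\<Sum>l\<in>{1..<i}. a l)"
    by (intro sum_mono2) auto
  then show False
    using assms by (simp add: mem_block_iff)
qed

lemma block_index_eqI:
  assumes "i \<in> {1..k}" "x \<in> block a i"
  shows "block_index a k x = i"
  unfolding block_index_def using assms by (intro the_equality) (auto intro: antisym block_mono)

locale block_partition =
  fixes n k :: nat and a :: "nat \<Rightarrow> nat" and S :: "nat set"
  assumes sum_a: "(\<Sum>i\<in>{1..k}. a i) = n"
begin

abbreviation color :: "nat \<Rightarrow> nat" where "color \<equiv> block_index a k"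

abbreviation word :: "(nat \<Rightarrow> nat) \<Rightarrow> nat \<Rightarrow> nat \<Rightarrow> nat" where "word \<equiv> orbit_word color"

lemma block_subset: "i \<in> {1..k} \<Longrightarrow> block a i \<subseteq> {1..n}"
proof
  fix x assume "i \<in> {1..k}" "x \<in> block a i"
  moreover from this have "(\<Sum>l\<in>{1..i}. a l) \<le> n"
    unfolding sum_a[symmetric] by (intro sum_mono2) auto
  ultimately show "x \<in> {1..n}"
    by (auto simp: mem_block_iff)
qed

lemma color_props:
  assumes "x \<in> {1..n}"
  shows "color x \<in> {1..k}" "x \<in> block a (color x)"
proof -
  \<comment> \<open>The first block whose right end reaches \<open>x\<close>. It is not block
    \<open>0\<close>, whose right end is the empty sum, because \<open>x\<close> is
    positive.\<close>
  define i where "i = (LEAST i. x \<le> (\<Sum>l\<in>{1..i}. a l))"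
  have ex: "x \<le> (\<Sum>l\<in>{1..k}. a l)"
    using assms sum_a by simp
  have le: "x \<le> (\<Sum>l\<in>{1..i}. a l)"
    unfolding i_def by (rule LeastI[of _ k]) (rule ex)
  have "i \<noteq> 0"
    using le assms by (cases i) auto
  then have i: "i - 1 < i" "{1..<i} = {1..i - 1}"
    by auto
  have "\<not> x \<le> (\<Sum>l\<in>{1..i - 1}. a l)"
    using i(1) not_less_Least unfolding i_def by blast
  then have "x \<in> block a i"
    using le i(2) by (simp add: mem_block_iff)
  moreover have "i \<in> {1..k}"
    using \<open>i \<noteq> 0\<close> Least_le[of "\<lambda>i. x \<le> (\<Sum>l\<in>{1..i}. a l)" k] ex unfolding i_def by simp
  ultimately show "color x \<in> {1..k}" "x \<in> block a (color x)"
    using block_index_eqI by auto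
qed

lemma color_mono: "x \<in> {1..n} \<Longrightarrow> y \<in> {1..n} \<Longrightarrow> x \<le> y \<Longrightarrow> color x \<le> color y"
  using block_mono color_props(2) by blast

lemma count_color: "count (image_mset color (mset_set {1..n})) i = (if i \<in> {1..k} then a i else 0)"
proof -
  have "count (image_mset color (mset_set {1..n})) i = card {x\<in>{1..n}. color x = i}"
    by (rule count_image_mset_mset_set) simp
  also have "{x\<in>{1..n}. color x = i} = (if i \<in> {1..k} then block a i else {})"
    using color_props block_index_eqI block_subset[THEN subsetD]
    by (auto simp del: atLeastAtMost_iff)
  also have "card \<dots> = (if i \<in> {1..k} then a i else 0)"
  proof (cases "i \<in> {1..k}")
    case True
    then have "{1..i} = insert i {1..<i}"
      by auto
    then show ?thesis
      using True by (simp add: block_def)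
  qed auto
  finally show ?thesis .
qed

text \<open>Blocks are intervals, so comparisons of neighbours chain along all points between
  \<open>x\<close> and \<open>y\<close>. This form compares arbitrary points of equal
  colour.\<close>

lemma AS_permutations_iff:
  "\<pi> \<in> AS_permutations n k a S \<longleftrightarrow> \<pi> permutes {1..n} \<and>
     (\<forall>x\<in>{1..n}. \<forall>y\<in>{1..n}. x < y \<and> color x = color y \<longrightarrow>
       (if color x \<in> S then \<pi> y < \<pi> x else \<pi> x < \<pi> y))" (is "_ \<longleftrightarrow> _ \<and> ?R")
proof -
  have "?R" if AS: "\<pi> \<in> AS_permutations n k a S"
  proof (intro ballI impI)
    have adjacent: "if i \<in> S then \<pi> (Suc j) < \<pi> j else \<pi> j < \<pi> (Suc j)"
      if "i \<in> {1..k}" "j \<in> block a i" "Suc j \<in> block a i" for i j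
      using AS that unfolding AS_permutations_def by (metis (mono_tags, lifting) Suc_eq_plus1 mem_Collect_eq)
    fix x y
    assume x: "x \<in> {1..n}" and y: "y \<in> {1..n}" and xy: "x < y \<and> color x = color y"
    have "if color x \<in> S then \<pi> z < \<pi> x else \<pi> x < \<pi> z" if "Suc x \<le> z" "z \<le> y" for z
      using that
    proof (induction z rule: dec_induct)
      case base
      then have "x \<in> block a (color x)" "Suc x \<in> block a (color x)"
        using color_props[OF x] color_props[OF y] xy by (auto simp: mem_block_iff)
      then show ?case
        using adjacent color_props(1)[OF x] by blast
    next
      case (step z)
      then have "z \<in> block a (color x)" "Suc z \<in> block a (color x)"
        using color_props[OF x] color_props[OF y] xy by (auto simp: mem_block_iff)
      then have "if color x \<in> S then \<pi> (Suc z) < \<pi> z else \<pi> z < \<pi> (Suc z)"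
        using adjacent color_props(1)[OF x] by blast
      then show ?case
        using step by (auto split: if_splits)
    qed
    then show "if color x \<in> S then \<pi> y < \<pi> x else \<pi> x < \<pi> y"
      using xy by auto
  qed
  moreover have "\<pi> \<in> AS_permutations n k a S" if "\<pi> permutes {1..n}" "?R"
    unfolding AS_permutations_def
  proof (intro CollectI conjI ballI allI impI)
    fix i j assume i: "i \<in> {1..k}" and j: "j \<in> block a i \<and> j + 1 \<in> block a i"
    then have in_n: "j \<in> {1..n}" "j + 1 \<in> {1..n}" and i_eq: "color j = i" "color (j + 1) = i"
      using block_subset block_index_eqI by blast+
    have "j < j + 1 \<and> color j = color (j + 1)"
      using i_eq by simp
    with that(2) in_n have "if color j \<in> S then \<pi> (j + 1) < \<pi> j else \<pi> j < \<pi> (j + 1)"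
      by blast
    then show "if i \<in> S then \<pi> j > \<pi> (j + 1) else \<pi> j < \<pi> (j + 1)"
      using i_eq(1) by simp
  qed (rule that(1))
  moreover have "\<pi> permutes {1..n}" if "\<pi> \<in> AS_permutations n k a S"
    using that by (simp add: AS_permutations_def)
  ultimately show ?thesis
    by blast
qed

section \<open>Comparison of points along their orbits\<close>

lemma AS_permutationD:
  assumes "\<pi> \<in> AS_permutations n k a S" "x \<in> {1..n}" "y \<in> {1..n}" "x < y" "color x = color y"
  shows "if color x \<in> S then \<pi> y < \<pi> x else \<pi> x < \<pi> y"
  using assms AS_permutations_iff by blast

lemma AS_permutes: "\<pi> \<in> AS_permutations n k a S \<Longrightarrow> \<pi> permutes {1..n}"
  by (simp add: AS_permutations_def)

lemma funpow_in: "\<pi> permutes {1..n} \<Longrightarrow> x \<in> {1..n} \<Longrightarrow> (\<pi> ^^ m) x \<in> {1..n}"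
  using permutes_funpow permutes_in_image by metis

text \<open>While the colours agree, each application of \<open>\<pi>\<close> preserves the order of
  the two points or, if the common colour lies in \<open>S\<close>, reverses it. The sign count is
  the number of reversals.\<close>

lemma compare_after_agreement:
  assumes AS: "\<pi> \<in> AS_permutations n k a S" and x: "x \<in> {1..n}" and y: "y \<in> {1..n}"
    and less: "x < y" and agree: "\<forall>i<m. word \<pi> x i = word \<pi> y i"
  shows "if even (sign_count S (word \<pi> x) m) then (\<pi> ^^ m) x < (\<pi> ^^ m) y else (\<pi> ^^ m) y < (\<pi> ^^ m) x"
  using agree
proof (induction m)
  case 0
  then show ?case
    using less by simp
next
  case (Suc m)
  have "color ((\<pi> ^^ m) x) = color ((\<pi> ^^ m) y)"
    using Suc.prems by (simp add: orbit_word_def)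
  moreover have "(\<pi> ^^ m) x \<in> {1..n}" "(\<pi> ^^ m) y \<in> {1..n}"
    using funpow_in[OF AS_permutes[OF AS]] x y by blast+
  moreover have "if even (sign_count S (word \<pi> x) m) then (\<pi> ^^ m) x < (\<pi> ^^ m) y else (\<pi> ^^ m) y < (\<pi> ^^ m) x"
    using Suc by simp
  ultimately show ?case
    using AS_permutationD[OF AS, of "(\<pi> ^^ m) x" "(\<pi> ^^ m) y"]
      AS_permutationD[OF AS, of "(\<pi> ^^ m) y" "(\<pi> ^^ m) x"]
    by (auto simp: sign_count_Suc orbit_word_def split: if_splits)
qed

text \<open>At the first difference of the words, \<open>compare_after_agreement\<close> orders the
  two images and \<open>color_mono\<close> orders their colours weakly in the same way. Thus the
  word of the larger point cannot be smaller.\<close>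

lemma words_sorted:
  assumes AS: "\<pi> \<in> AS_permutations n k a S" and xy: "x \<in> {1..n}" "y \<in> {1..n}" "x < y"
  shows "\<not> word_less S (word \<pi> y) (word \<pi> x)"
proof
  assume "word_less S (word \<pi> y) (word \<pi> x)"
  then obtain d where d: "\<forall>i<d. word \<pi> y i = word \<pi> x i"
    "if even (sign_count S (word \<pi> y) d) then word \<pi> y d < word \<pi> x d else word \<pi> x d < word \<pi> y d"
    unfolding word_less_def by auto
  have "sign_count S (word \<pi> y) d = sign_count S (word \<pi> x) d"
    using d(1) by (intro sign_count_cong) auto
  moreover have "(\<pi> ^^ d) x \<in> {1..n}" "(\<pi> ^^ d) y \<in> {1..n}"
    using funpow_in[OF AS_permutes[OF AS]] xy by blast+
  ultimately show False
    using compare_after_agreement[OF AS xy, of d] d color_mono[of "(\<pi> ^^ d) x" "(\<pi> ^^ d) y"]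
      color_mono[of "(\<pi> ^^ d) y" "(\<pi> ^^ d) x"]
    by (auto simp: orbit_word_def split: if_splits)
qed

text \<open>
  On the points with a common word of even period, the corresponding power of \<open>\<pi>\<close> is increasing;
  as it has finite order, it is the identity.
\<close>

lemma even_period_fixes:
  assumes AS: "\<pi> \<in> AS_permutations n k a S" and x: "x \<in> {1..n}"
    and per: "is_period (word \<pi> x) p" and even: "even (sign_count S (word \<pi> x) p)"
  shows "(\<pi> ^^ p) x = x"
proof -
  define g where "g j = (\<pi> ^^ (p * j)) x" for j
  define L where "L = least_power \<pi> x"
  note perm = permutes_atLeastAtMost_permutation[OF AS_permutes[OF AS]]
  have L: "L > 0" "(\<pi> ^^ L) x = x"
    unfolding L_def using least_power_of_permutation[OF perm] by auto
  have "(\<pi> ^^ (p * L)) x = x"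
    using least_power_dvd[OF perm, of x] unfolding L_def by (metis dvd_triv_right)
  then have gL: "g L = x" "g 0 = x" "g 1 = (\<pi> ^^ p) x"
    by (simp_all add: g_def)
  have g: "g j \<in> {1..n}" "word \<pi> (g j) = word \<pi> x" for j
    using funpow_in[OF AS_permutes[OF AS] x] is_period_mult[OF per]
    unfolding g_def by (auto simp: is_period_def shift_orbit_word)
  have g_Suc: "g (Suc j) = (\<pi> ^^ p) (g j)" for j
    by (simp add: g_def funpow_add)
  \<comment> \<open>All points \<open>g j\<close> have the same word, so \<open>p\<close> further
    steps preserve their order because the sign count is even.\<close>
  have step: "g (Suc i) < g (Suc j)" if "g i < g j" for i j
    using compare_after_agreement[OF AS g(1) g(1) that, of p] even g(2) by (simp add: g_Suc)
  have inc: "g 0 < g (Suc j)" if "g 0 < g 1" for j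
  proof (induction j)
    case (Suc j)
    then show ?case
      using step[OF Suc] that by simp
  qed (use that in simp)
  have dec: "g (Suc j) < g 0" if "g 1 < g 0" for j
  proof (induction j)
    case (Suc j)
    then show ?case
      using step[OF Suc] that by simp
  qed (use that in simp)
  \<comment> \<open>The sequence \<open>g\<close> returns to its start at the positive index
    \<open>L\<close>, whereas a strict first step in either direction would keep it on that side of
    \<open>g 0\<close>.\<close>
  have "L = Suc (L - 1)"
    using L by simp
  then have "\<not> g 0 < g 1" "\<not> g 1 < g 0"
    using inc[of "L - 1"] dec[of "L - 1"] gL by (metis less_irrefl)+
  then show ?thesis
    using gL by simp
qed

text \<open>The word repeats after a full cycle, so the cycle length is a multiple of
  \<open>p\<close>. By \<open>even_period_fixes\<close> it divides \<open>p\<close> if the sign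
  count over \<open>p\<close> is even, and otherwise \<open>p * 2\<close>, since doubling the period
  makes the count even.\<close>

lemma cycle_length_cases:
  assumes AS: "\<pi> \<in> AS_permutations n k a S" and x: "x \<in> {1..n}"
  defines "p \<equiv> min_period (word \<pi> x)"
  shows "even (sign_count S (word \<pi> x) p) \<Longrightarrow> least_power \<pi> x = p"
    and "odd (sign_count S (word \<pi> x) p) \<Longrightarrow> least_power \<pi> x = p \<or> least_power \<pi> x = p * 2"
proof -
  note perm = permutes_atLeastAtMost_permutation[OF AS_permutes[OF AS]]
  define L where "L = least_power \<pi> x"
  have L: "L > 0" "(\<pi> ^^ L) x = x"
    unfolding L_def using least_power_of_permutation[OF perm] by auto
  then have "is_period (word \<pi> x) L"
    by (simp add: is_period_def shift_orbit_word)
  then have p: "p > 0" "is_period (word \<pi> x) p" "p dvd L"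
    unfolding p_def using min_period is_period_iff_dvd L(1) by blast+
  show "least_power \<pi> x = p" if "even (sign_count S (word \<pi> x) p)"
    using even_period_fixes[OF AS x p(2) that] least_power_minimal[of p \<pi> x] p(3)
    unfolding L_def by (simp add: dvd_antisym)
  show "least_power \<pi> x = p \<or> least_power \<pi> x = p * 2" if "odd (sign_count S (word \<pi> x) p)"
  proof -
    have "(\<pi> ^^ (p * 2)) x = x"
      using even_period_fixes[OF AS x is_period_mult[OF p(2)]] sign_count_mult[OF p(2)] by simp
    then have "L dvd p * 2"
      unfolding L_def by (rule least_power_minimal)
    moreover obtain r where "L = p * r"
      using p(3) by blast
    ultimately have "L = p * r" "r dvd 2"
      using p(1) by auto
    have "r \<noteq> 0"
      using L(1) \<open>L = p * r\<close> by auto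
    moreover have "r \<le> 2"
      using \<open>r dvd 2\<close> by (rule dvd_imp_le) simp
    ultimately have "r = 1 \<or> r = 2"
      by auto
    then show ?thesis
      using \<open>L = p * r\<close> unfolding L_def by auto
  qed
qed

end

section \<open>The ornament of a permutation\<close>

lemma image_hd_ornament_words:
  "image_mset (\<lambda>w. w 0) (ornament_words \<Omega>) = (\<Sum>N\<in>#\<Omega>. necklace_entries N)"
  by (induction \<Omega>) (auto simp: ornament_words_def image_hd_necklace_words)

lemma image_shift_ornament_words: "image_mset (shift 1) (ornament_words \<Omega>) = ornament_words \<Omega>"
  by (induction \<Omega>) (simp_all add: ornament_words_def image_shift_necklace_words del: One_nat_def shift_apply)

lemma mem_ornament_words: "w \<in># ornament_words \<Omega> \<longleftrightarrow> (\<exists>N. N \<in># \<Omega> \<and> w \<in># necklace_words N)"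
  by (auto simp: ornament_words_def)

lemma image_mset_permutes:
  assumes "p permutes A"
  shows "image_mset p (mset_set A) = mset_set A"
  using assms by (simp add: image_mset_mset_set permutes_inj_on permutes_image)

text \<open>Under the hypothesis, \<open>\<rho>\<close> composed with the inverse of
  \<open>\<pi>\<close> is a sorted listing of \<open>{1..n}\<close>, hence the identity
  there.\<close>

lemma permutes_eqI:
  fixes \<pi> \<rho> :: "nat \<Rightarrow> nat"
  assumes perm: "\<pi> permutes {1..n}" "\<rho> permutes {1..n}"
    and mono: "\<And>x y. x \<in> {1..n} \<Longrightarrow> y \<in> {1..n} \<Longrightarrow> \<pi> x < \<pi> y \<Longrightarrow> \<not> \<rho> y < \<rho> x"
  shows "\<pi> = \<rho>"
proof
  fix x
  note inv = permutes_inv[OF perm(1)]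
  show "\<pi> x = \<rho> x"
  proof (cases "x \<in> {1..n}")
    case True
    have "image_mset (\<lambda>y. \<rho> (inv \<pi> y)) (mset_set {1..n}) = image_mset \<rho> (image_mset (inv \<pi>) (mset_set {1..n}))"
      by (simp add: multiset.map_comp comp_def)
    then have image: "image_mset (\<lambda>y. \<rho> (inv \<pi> y)) (mset_set {1..n}) = image_mset (\<lambda>y. y) (mset_set {1..n})"
      using image_mset_permutes[OF inv] image_mset_permutes[OF perm(2)] by simp
    have sorted: "\<not> \<rho> (inv \<pi> z) < \<rho> (inv \<pi> y)" if "y \<in> {1..n}" "z \<in> {1..n}" "y < z" for y z
      using mono[of "inv \<pi> y" "inv \<pi> z"] that permutes_in_image[OF inv] permutes_inverses(1)[OF perm(1)]
      by metis
    have "\<rho> (inv \<pi> y) = y" if "y \<in> {1..n}" for y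
      by (rule sorted_listing_unique[of "(<)" n, OF _ _ _ sorted _ image that])
        (auto simp: transp_def irreflp_def totalp_on_def)
    from this[of "\<pi> x"] show ?thesis
      using True permutes_in_image[OF perm(1)] permutes_inverses(2)[OF perm(1)] by metis
  next
    case False
    then show ?thesis
      using perm permutes_not_in by metis
  qed
qed

context block_partition
begin

lemma mem_ornament_of:
  "N \<in># ornament_of n k a \<pi> \<longleftrightarrow> (\<exists>x\<in>{1..n}. N = necklace_of (map color (support \<pi> x)))"
proof -
  have "set_mset (ornament_of n k a \<pi>) = recolor color ` disjoint_cycles n \<pi>"
    by (simp add: ornament_of_def disjoint_cycles_def)
  then show ?thesis
    by (auto simp: disjoint_cycles_def image_iff simp del: map_map)
qed

lemma ornament_word_cases:
  assumes \<pi>: "\<pi> permutes {1..n}" and N: "N \<in># ornament_of n k a \<pi>" and w: "w \<in># necklace_words N"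
  obtains y where "y \<in> {1..n}" "w = word \<pi> y" "necklace_length N = least_power \<pi> y"
proof -
  note perm = permutes_atLeastAtMost_permutation[OF \<pi>]
  obtain x where x: "x \<in> {1..n}" "N = necklace_of (map color (support \<pi> x))"
    using N mem_ornament_of by blast
  have "finite (orbit \<pi> x)"
    by (intro finite_orbit permutation_self_in_orbit perm)
  then obtain y where y: "y \<in> orbit \<pi> x" "w = word \<pi> y"
    using w unfolding x(2) necklace_words_support[OF perm] by auto
  have "least_power \<pi> x = least_power \<pi> y"
    using y(1) orbit_eq_iff[OF perm] support_props(3)[OF perm] by metis
  moreover have "necklace_length N = least_power \<pi> x"
    by (simp add: x(2))
  moreover have "y \<in> {1..n}"
    using permutes_orbit_subset[OF \<pi> x(1)] y(1) by blast
  ultimately show thesis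
    using that y(2) by simp
qed

text \<open>Every cycle coloured as \<open>N\<close> contains a point with word \<open>w\<close>
  that is fixed by the power of \<open>\<pi>\<close> with exponent the length of \<open>N\<close>.
  An odd sign count makes this power reverse the order of any two such points, so there is only
  one.\<close>

lemma count_ornament_of_odd:
  assumes AS: "\<pi> \<in> AS_permutations n k a S" and N: "N \<in># ornament_of n k a \<pi>"
    and w: "w \<in># necklace_words N" and odd: "odd (sign_count S w (necklace_length N))"
  shows "count (ornament_of n k a \<pi>) N = 1"
proof -
  note \<pi> = AS_permutes[OF AS]
  note perm = permutes_atLeastAtMost_permutation[OF \<pi>]
  let ?D = "{C \<in> disjoint_cycles n \<pi>. recolor color C = N}"
  have point: "\<exists>y\<in>{1..n}. C = necklace_of (support \<pi> y) \<and> word \<pi> y = w \<and> (\<pi> ^^ necklace_length N) y = y"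
    if C: "C \<in> ?D" for C
  proof -
    obtain x where x: "x \<in> {1..n}" "C = necklace_of (support \<pi> x)"
      using C unfolding disjoint_cycles_def by blast
    then have N: "N = necklace_of (map color (support \<pi> x))"
      using C by auto
    have "finite (orbit \<pi> x)"
      by (intro finite_orbit permutation_self_in_orbit perm)
    then obtain y where y: "y \<in> orbit \<pi> x" "w = word \<pi> y"
      using w unfolding N necklace_words_support[OF perm] by auto
    have eq: "orbit \<pi> x = orbit \<pi> y"
      using y(1) orbit_eq_iff[OF perm] by metis
    then have "necklace_length N = least_power \<pi> y"
      using support_props(3)[OF perm] by (simp add: N) metis
    moreover have "C = necklace_of (support \<pi> y)"
      using x(2) eq necklace_of_support_eq_iff[OF perm] by metis
    moreover have "y \<in> {1..n}"
      using permutes_orbit_subset[OF \<pi> x(1)] y(1) by blast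
    ultimately show ?thesis
      using y(2) least_power_of_permutation(1)[OF perm] by metis
  qed
  have unique: "\<not> y < z" if "y \<in> {1..n}" "z \<in> {1..n}" "word \<pi> y = w" "word \<pi> z = w"
    "(\<pi> ^^ necklace_length N) y = y" "(\<pi> ^^ necklace_length N) z = z" for y z
    using compare_after_agreement[OF AS that(1,2), of "necklace_length N"] that odd by auto
  have "C = C'" if "C \<in> ?D" "C' \<in> ?D" for C C'
    using point[OF that(1)] point[OF that(2)] unique by (metis linorder_neqE_nat)
  moreover have "?D \<noteq> {}"
    using N by (auto simp: ornament_of_def disjoint_cycles_def)
  ultimately obtain C where "?D = {C}"
    by blast
  then have "card ?D = 1"
    by simp
  then show ?thesis
    unfolding ornament_of_def by (subst count_image_mset_mset_set) (simp_all add: disjoint_cycles_def)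
qed

lemma admissible_ornament_of:
  assumes AS: "\<pi> \<in> AS_permutations n k a S"
  shows "admissible S (ornament_of n k a \<pi>)"
  unfolding admissible_def
proof (intro ballI conjI impI)
  fix N w
  assume N: "N \<in># ornament_of n k a \<pi>" and w: "w \<in># necklace_words N"
  obtain y where y: "y \<in> {1..n}" "w = word \<pi> y" "necklace_length N = least_power \<pi> y"
    using ornament_word_cases[OF AS_permutes[OF AS] N w] .
  show "necklace_length N = min_period w" if "even (sign_count S w (min_period w))"
    using cycle_length_cases(1)[OF AS y(1)] that y by simp
  show "necklace_length N = min_period w \<or> necklace_length N = min_period w * 2"
    if "odd (sign_count S w (min_period w))"
    using cycle_length_cases(2)[OF AS y(1)] that y by simp
  show "count (ornament_of n k a \<pi>) N = 1" if "odd (sign_count S w (necklace_length N))"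
    by (rule count_ornament_of_odd[OF AS N w that])
qed

lemma necklace_length_ornament_of:
  assumes "\<pi> permutes {1..n}" "N \<in># ornament_of n k a \<pi>"
  shows "necklace_length N > 0"
proof -
  obtain x where "N = necklace_of (map color (support \<pi> x))"
    using assms(2) mem_ornament_of by blast
  then show ?thesis
    using least_power_of_permutation(2)[OF permutes_atLeastAtMost_permutation[OF assms(1)]] by simp
qed

lemma ornament_of_in_ornaments:
  assumes \<pi>: "\<pi> permutes {1..n}"
  shows "ornament_of n k a \<pi> \<in> ornaments k"
proof -
  have "set_mset (necklace_entries N) \<subseteq> {1..k}" if N: "N \<in># ornament_of n k a \<pi>" for N
  proof -
    obtain x where x: "x \<in> {1..n}" "N = necklace_of (map color (support \<pi> x))"
      using N mem_ornament_of by blast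
    have "set_mset (necklace_entries N) = color ` set (support \<pi> x)"
      unfolding x(2) necklace_entries_of set_mset_mset set_map ..
    moreover have "set (support \<pi> x) \<subseteq> {1..n}"
      unfolding support_props(2)[OF permutes_atLeastAtMost_permutation[OF \<pi>]]
      by (rule permutes_orbit_subset[OF \<pi> x(1)])
    moreover have "color ` {1..n} \<subseteq> {1..k}"
      using color_props(1) by blast
    ultimately show ?thesis
      by (metis image_mono subset_trans)
  qed
  then show ?thesis
    using necklace_length_ornament_of[OF \<pi>] unfolding ornaments_def by blast
qed

text \<open>The colour of a vertex is the first letter of the word read there, so compatibility
  depends only on the multiset of words.\<close>

lemma compatible_iff:
  "compatible k a \<Omega> \<longleftrightarrow>
     (\<forall>i\<in>{1..k}. count (image_mset (\<lambda>w. w 0) (ornament_words \<Omega>)) i = a i)"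
  unfolding compatible_def image_hd_ornament_words count_sum_mset_image ..

lemma image_hd_orbit_words:
  assumes "\<pi> permutes {1..n}"
  shows "image_mset (\<lambda>w. w 0) (ornament_words (ornament_of n k a \<pi>)) = image_mset color (mset_set {1..n})"
  unfolding ornament_words_ornament_of[OF assms] by (simp add: multiset.map_comp comp_def orbit_word_def)

lemma compatible_ornament_of:
  assumes "\<pi> permutes {1..n}"
  shows "compatible k a (ornament_of n k a \<pi>)"
  unfolding compatible_iff image_hd_orbit_words[OF assms] count_color by simp

text \<open>The words are sorted and their multiset is known, so each point has the same word under
  both permutations. If these ordered the images of two points differently, the shifted words would
  coincide, hence the words and colours too, and then the prescribed ascent or descent fixes the
  order for both.\<close>

lemma ornament_of_inj: "inj_on (ornament_of n k a) (AS_permutations n k a S)"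
proof (rule inj_onI)
  fix \<pi> \<rho>
  assume \<pi>: "\<pi> \<in> AS_permutations n k a S" and \<rho>: "\<rho> \<in> AS_permutations n k a S"
    and eq: "ornament_of n k a \<pi> = ornament_of n k a \<rho>"
  note perm = AS_permutes[OF \<pi>] AS_permutes[OF \<rho>]
  have word_eq: "word \<pi> x = word \<rho> x" if "x \<in> {1..n}" for x
  proof (rule sorted_listing_unique[OF transp_word_less irreflp_word_less totalp_word_less _ _ _ that])
    show "image_mset (word \<pi>) (mset_set {1..n}) = image_mset (word \<rho>) (mset_set {1..n})"
      using eq ornament_words_ornament_of perm by metis
  qed (fact words_sorted[OF \<pi>] words_sorted[OF \<rho>])+
  have shift1: "word p (p x) = shift 1 (word p x)" for p x
    by (simp add: shift_orbit_word)
  show "\<pi> = \<rho>"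
  proof (rule permutes_eqI[OF perm])
    fix x y
    assume x: "x \<in> {1..n}" and y: "y \<in> {1..n}" and less: "\<pi> x < \<pi> y"
    show "\<not> \<rho> y < \<rho> x"
    proof
      assume less': "\<rho> y < \<rho> x"
      have mem: "\<pi> x \<in> {1..n}" "\<pi> y \<in> {1..n}" "\<rho> x \<in> {1..n}" "\<rho> y \<in> {1..n}"
        using x y perm permutes_in_image by metis+
      have "\<not> word_less S (shift 1 (word \<pi> y)) (shift 1 (word \<pi> x))"
        using words_sorted[OF \<pi> mem(1,2) less] by (simp add: shift1)
      \<comment> \<open>Sortedness along \<open>\<rho>\<close> bounds the same two shifted words in
        the opposite direction, because \<open>word_eq\<close> identifies the words of both
        permutations.\<close>
      moreover have "\<not> word_less S (shift 1 (word \<pi> x)) (shift 1 (word \<pi> y))"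
        using words_sorted[OF \<rho> mem(4,3) less'] by (simp add: shift1 word_eq[OF x] word_eq[OF y])
      ultimately have "shift 1 (word \<pi> x) = shift 1 (word \<pi> y)"
        using totalpD[OF totalp_word_less] by metis
      moreover have "is_period (word \<pi> z) (least_power \<pi> z)" "least_power \<pi> z > 0" for z
        using least_power_of_permutation[OF permutes_atLeastAtMost_permutation[OF perm(1)]]
        by (auto simp: is_period_def shift_orbit_word)
      ultimately have "word \<pi> x = word \<pi> y"
        using shift_inj_periodic by metis
      then have "color x = color y"
        unfolding orbit_word_def by (metis funpow_0)
      then show False
        using AS_permutationD[OF \<pi> x y] AS_permutationD[OF \<rho> x y]
          AS_permutationD[OF \<pi> y x] AS_permutationD[OF \<rho> y x] less less'
        by (cases x y rule: linorder_cases) (auto split: if_splits)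
    qed
  qed
qed

text \<open>
  Listing the words of the ornament in increasing order, one obtains the permutation by ranking the
  points according to the shifted words, equal words being compared as the colour of the point requires.
\<close>

lemma AS_permutation_of_words:
  assumes \<Omega>: "\<Omega> \<in> ornaments k" and comp: "compatible k a \<Omega>"
  obtains \<pi> where "\<pi> \<in> AS_permutations n k a S"
    "ornament_words (ornament_of n k a \<pi>) = ornament_words \<Omega>"
proof -
  let ?T = "ornament_words \<Omega>"
  \<comment> \<open>Compatibility gives the counts of the colours in \<open>{1..k}\<close>, and no
    other colour occurs in a member of \<open>ornaments k\<close>. In particular there are
    \<open>n\<close> words.\<close>
  have hd: "image_mset (\<lambda>w. w 0) ?T = image_mset color (mset_set {1..n})"
  proof (rule multiset_eqI)
    fix i
    show "count (image_mset (\<lambda>w. w 0) ?T) i = count (image_mset color (mset_set {1..n})) i"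
    proof (cases "i \<in> {1..k}")
      case True
      then show ?thesis
        using comp unfolding compatible_iff count_color by simp
    next
      case False
      then have "\<not> i \<in># (\<Sum>N\<in>#\<Omega>. necklace_entries N)"
        using \<Omega> by (fastforce simp: ornaments_def)
      then show ?thesis
        unfolding count_color image_hd_ornament_words using False by (simp only: not_in_iff if_False)
    qed
  qed
  have size: "size ?T = n"
    using arg_cong[OF hd, of size] by simp
  obtain w where w: "image_mset w (mset_set {1..n}) = ?T"
      and sorted: "\<And>x y. x \<in> {1..n} \<Longrightarrow> y \<in> {1..n} \<Longrightarrow> x < y \<Longrightarrow> \<not> word_less S (w y) (w x)"
    using sorted_listing_exists[OF transp_word_less irreflp_word_less totalp_word_less, of ?T S]
    unfolding size by metis
  note trans = transpD[OF transp_word_less] and irrefl = irreflpD[OF irreflp_word_less]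
    and total = totalpD[OF totalp_word_less]
  have periodic: "\<exists>d>0. is_period (w x) d" if "x \<in> {1..n}" for x
  proof -
    have "w x \<in># ?T"
      unfolding w[symmetric] using that by simp
    then show ?thesis
      unfolding mem_ornament_words using necklace_wordD(1,2) by blast
  qed
  have shift_inj: "w x = w y" if "x \<in> {1..n}" "y \<in> {1..n}" "shift 1 (w x) = shift 1 (w y)" for x y
    using periodic[OF that(1)] periodic[OF that(2)] shift_inj_periodic that(3) by metis
  \<comment> \<open>A smaller first letter makes a word smaller, so the first letters of the sorted
    words are sorted, as are the colours, with the same multiset.\<close>
  have color: "color x = w x 0" if "x \<in> {1..n}" for x
  proof (rule sorted_listing_unique[of "(<)" n color "\<lambda>x. w x 0", OF _ _ _ _ _ _ that])
    show "image_mset color (mset_set {1..n}) = image_mset (\<lambda>x. w x 0) (mset_set {1..n})"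
      unfolding hd[symmetric] w[symmetric] by (simp add: multiset.map_comp comp_def)
    show "\<not> w y 0 < w x 0" if "x \<in> {1..n}" "y \<in> {1..n}" "x < y" for x y
      using sorted[OF that] word_less_hd by metis
    show "\<not> color y < color x" if "x \<in> {1..n}" "y \<in> {1..n}" "x < y" for x y
      using color_mono[OF that(1,2)] that(3) by simp
  qed (auto simp: transp_def irreflp_def totalp_on_def)
  \<comment> \<open>The intended order of the images. By \<open>shift_inj\<close>, a tie between
    shifted words is already a tie between the words themselves, so the second clause settles every
    tie.\<close>
  define R where "R x y \<longleftrightarrow> word_less S (shift 1 (w x)) (shift 1 (w y)) \<or>
      w x = w y \<and> (if w x 0 \<in> S then y < x else x < y)" for x y
  obtain r where r: "bij_betw r {1..n} {1..n}"
      and r_less: "\<And>x y. x \<in> {1..n} \<Longrightarrow> y \<in> {1..n} \<Longrightarrow> r x < r y \<longleftrightarrow> R x y"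
  proof (rule ranking_exists[of "{1..n}" R])
    show "R u z" if "R u v" "R v z" for u v z
      using that trans unfolding R_def by (auto split: if_splits)
    show "\<not> R u u" for u
      using irrefl by (auto simp: R_def)
    show "R u v \<or> R v u" if "u \<in> {1..n}" "v \<in> {1..n}" "u \<noteq> v" for u v
      using total shift_inj[OF that(1,2)] that(3) unfolding R_def by (metis linorder_neqE_nat)
  qed (use that in auto)
  define \<pi> where "\<pi> x = (if x \<in> {1..n} then r x else x)" for x
  have perm: "\<pi> permutes {1..n}"
  proof (rule bij_imp_permutes)
    show "bij_betw \<pi> {1..n} {1..n}"
      using r by (subst bij_betw_cong[of _ \<pi> r]) (simp_all add: \<pi>_def)
  qed (auto simp: \<pi>_def)
  have \<pi>_less: "\<pi> x < \<pi> y \<longleftrightarrow> R x y" if "x \<in> {1..n}" "y \<in> {1..n}" for x y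
    using r_less that by (simp add: \<pi>_def)
  note inv = permutes_inv[OF perm]
  \<comment> \<open>By the definition of \<open>R\<close>, the shifted words listed along the
    inverse of \<open>\<pi>\<close> are sorted. They form the same multiset as the words, since
    shifting preserves it, so the two listings coincide.\<close>
  have w_inv: "w y = shift 1 (w (inv \<pi> y))" if "y \<in> {1..n}" for y
  proof (rule sorted_listing_unique[OF transp_word_less irreflp_word_less totalp_word_less _ _ _ that])
    have "image_mset (\<lambda>y. shift 1 (w (inv \<pi> y))) (mset_set {1..n})
        = image_mset (shift 1) (image_mset w (image_mset (inv \<pi>) (mset_set {1..n})))"
      by (simp add: multiset.map_comp comp_def)
    also have "\<dots> = image_mset w (mset_set {1..n})"
      unfolding image_mset_permutes[OF inv] w by (rule image_shift_ornament_words)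
    finally show "image_mset w (mset_set {1..n}) = image_mset (\<lambda>y. shift 1 (w (inv \<pi> y))) (mset_set {1..n})"
      by (rule sym)
    show "\<not> word_less S (shift 1 (w (inv \<pi> y))) (shift 1 (w (inv \<pi> x)))"
      if "x \<in> {1..n}" "y \<in> {1..n}" "x < y" for x y
    proof -
      have "R (inv \<pi> x) (inv \<pi> y)"
        using that \<pi>_less[of "inv \<pi> x" "inv \<pi> y"] permutes_in_image[OF inv] permutes_inverses(1)[OF perm]
        by simp
      then show ?thesis
        unfolding R_def using trans irrefl by metis
    qed
  qed (fact sorted)
  have w_\<pi>: "w (\<pi> x) = shift 1 (w x)" if "x \<in> {1..n}" for x
    using w_inv[of "\<pi> x"] that permutes_in_image[OF perm] permutes_inverses(2)[OF perm] by simp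
  have w_funpow: "w ((\<pi> ^^ i) x) = shift i (w x)" if "x \<in> {1..n}" for x i
  proof (induction i)
    case (Suc i)
    have "w (\<pi> ((\<pi> ^^ i) x)) = shift 1 (shift i (w x))"
      unfolding w_\<pi>[OF funpow_in[OF perm that]] Suc ..
    then show ?case
      by simp
  qed simp
  have word: "word \<pi> x = w x" if "x \<in> {1..n}" for x
    using color[OF funpow_in[OF perm that]] w_funpow[OF that] by (auto simp: orbit_word_def fun_eq_iff)
  have "if color x \<in> S then \<pi> y < \<pi> x else \<pi> x < \<pi> y"
    if "x \<in> {1..n}" "y \<in> {1..n}" "x < y" "color x = color y" for x y
  proof (cases "w x = w y")
    case True
    then show ?thesis
      using that \<pi>_less color by (simp add: R_def)
  next
    case False
    \<comment> \<open>The words share their first letter, so dropping it preserves or reverses this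
      comparison as the colour demands, and \<open>\<pi>\<close> ranks by the shifted words.\<close>
    then have "word_less S (w x) (w y)"
      using total sorted[OF that(1-3)] by metis
    then show ?thesis
      using word_less_shift[of S "w x" "w y"] that \<pi>_less color by (auto simp: R_def split: if_splits)
  qed
  then have "\<pi> \<in> AS_permutations n k a S"
    unfolding AS_permutations_iff using perm by blast
  moreover have "ornament_words (ornament_of n k a \<pi>) = ?T"
    unfolding ornament_words_ornament_of[OF perm] w[symmetric]
    by (intro image_mset_cong) (simp add: word)
  ultimately show thesis
    by (rule that)
qed

lemma image_ornament_of:
  "ornament_of n k a ` AS_permutations n k a S =
    {\<Omega> \<in> ornaments k. compatible k a \<Omega> \<and> admissible S \<Omega>}"
proof (intro equalityI subsetI)
  fix \<Omega> assume "\<Omega> \<in> ornament_of n k a ` AS_permutations n k a S"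
  then show "\<Omega> \<in> {\<Omega> \<in> ornaments k. compatible k a \<Omega> \<and> admissible S \<Omega>}"
    using admissible_ornament_of ornament_of_in_ornaments compatible_ornament_of AS_permutes by auto
next
  fix \<Omega> assume "\<Omega> \<in> {\<Omega> \<in> ornaments k. compatible k a \<Omega> \<and> admissible S \<Omega>}"
  then have \<Omega>: "\<Omega> \<in> ornaments k" "compatible k a \<Omega>" "admissible S \<Omega>"
    by auto
  obtain \<pi> where \<pi>: "\<pi> \<in> AS_permutations n k a S"
      "ornament_words (ornament_of n k a \<pi>) = ornament_words \<Omega>"
    using AS_permutation_of_words[OF \<Omega>(1,2)] .
  \<comment> \<open>The permutation is only known to have the same multiset of words as the
    ornament. Admissibility of both sides turns this into equality of ornaments.\<close>
  have "ornament_of n k a \<pi> = \<Omega>"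
    using admissible_eqI[OF admissible_ornament_of[OF \<pi>(1)] \<Omega>(3) _ \<pi>(2)]
      necklace_length_ornament_of[OF AS_permutes[OF \<pi>(1)]] \<Omega>(1)
    by (auto simp: ornaments_def)
  then show "\<Omega> \<in> ornament_of n k a ` AS_permutations n k a S"
    using \<pi>(1) by blast
qed

end

theorem theorem2p3:
  fixes n k :: nat and a :: "nat \<Rightarrow> nat" and S :: "nat set"
  assumes "n \<ge> 1"
    and "\<forall>i\<in>{1..k}. a i > 0"
    and "(\<Sum>i\<in>{1..k}. a i) = n"
    and "S \<subseteq> {1..k}"
  shows "inj_on (ornament_of n k a) (AS_permutations n k a S) \<and>
    (\<forall>\<pi> \<in> AS_permutations n k a S.
       image_mset necklace_length (ornament_of n k a \<pi>) = cycle_lengths n \<pi>) \<and>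
    ornament_of n k a ` AS_permutations n k a S =
      {\<Omega> \<in> ornaments k. compatible k a \<Omega> \<and>
         (\<forall>N\<in>#\<Omega>. \<forall>P. fundamental_period N P \<and> even (length (filter (\<lambda>c. c \<in> S) P)) \<longrightarrow>
            repeating 1 N) \<and>
         (\<forall>N\<in>#\<Omega>. \<forall>P. fundamental_period N P \<and> odd (length (filter (\<lambda>c. c \<in> S) P)) \<longrightarrow>
            repeating 1 N \<or> repeating 2 N) \<and>
         (\<forall>N\<in>#\<Omega>. odd (size (filter_mset (\<lambda>c. c \<in> S) (necklace_entries N))) \<longrightarrow>
            count \<Omega> N = 1)}"
proof -
  interpret block_partition n k a S
    using assms(3) by unfold_locales
  show ?thesis
  proof (intro conjI ballI, goal_cases)
    case 1
    show ?case
      by (rule ornament_of_inj)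
  next
    case (2 \<pi>)
    then show ?case
      by (intro cycle_lengths_ornament_of AS_permutes)
  next
    case 3
    show ?case
      unfolding image_ornament_of
      by (intro Collect_cong conj_cong refl admissible_iff) (simp add: ornaments_def)
  qed
qed

end
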